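(* Let $\beta$ be a real number with $0<\beta\le1/2$, and let $k=k(n)$ be positive integers with $k=\beta n+o(n)$. Then $$\operatorname{Hdepth}_1M(n,k)=(1-\gamma)n+o(n),\qquad n\to\infty,$$ where $\gamma$ is the smallest nonnegative solution of the equation $$\frac{(\alpha+\gamma)^{\alpha+\gamma}(\alpha+\beta)^{\alpha+\beta}(1-\alpha-\beta-\gamma)^{1-\alpha-\beta-\gamma}}{\alpha^{\alpha}\beta^{\beta}\gamma^{\gamma}(1-\beta)^{1-\beta}(1-\gamma)^{1-\gamma}}=1,$$ with $$\alpha=\frac14\Big(1-2\beta-2\gamma+\sqrt{(1-2\beta-2\gamma)^2-8\beta\gamma}\Big).$$
   Context: $K$ is a field, $R=K[X_1,\dots,X_n]$ with the standard grading ($\deg X_i=1$). $M(n,k)$ is the $k$-th syzygy module of $K=R/(X_1,\dots,X_n)$ in the Koszul complex: the image of $\partial:\bigwedge^kR^n\to\bigwedge^{k-1}R^n$, $\partial(e_{i_1}\wedge\dots\wedge e_{i_k})=\sum_{r=1}^k(-1)^{r+1}X_{i_r}e_{i_1}\wedge\dots\widehat{e_{i_r}}\dots\wedge e_{i_k}$, where $e_{i_1}\wedge\dots\wedge e_{i_k}$ has degree $k$. A graded retract of $R$ is a $K$-subalgebra generated by a set of linear forms. A Hilbert decomposition of $M$ is a finite family $(S_i,s_i)$, $s_i\in\mathbb{Z}$, $S_i$ graded retracts, with $M\cong\bigoplus_iS_i(-s_i)$ as graded $K$-vector spaces; its depth is $\min_i\dim S_i$; $\operatorname{Hdepth}_1M$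 is the maximal depth of such a decomposition. The convention $0^0=1$ is used. *)

theory Defs
  imports Complex_Main "HOL-Library.Poly_Mapping" "HOL-Library.Landau_Symbols" "HOL-Library.Function_Algebras"
begin

text \<open>Polynomials over a field K in variables X_0, X_1, ...; monomials are exponent
  vectors (finitely supported functions nat to nat).  The ring R = K[X_1..X_n] is realised by the polynomials
  whose monomials only involve the variables with index < n.\<close>

type_synonym 'a mpoly = "(nat \<Rightarrow>\<^sub>0 nat) \<Rightarrow>\<^sub>0 'a"

definition Var :: "nat \<Rightarrow> 'a::field mpoly" where
  "Var i = Poly_Mapping.single (Poly_Mapping.single i 1) 1"

definition cscale :: "'a::field \<Rightarrow> 'a mpoly \<Rightarrow> 'a mpoly" where
  "cscale c p = Poly_Mapping.single 0 c * p"

definition mon_deg :: "(nat \<Rightarrow>\<^sub>0 nat) \<Rightarrow> nat" where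
  "mon_deg m = (\<Sum>i\<in>Poly_Mapping.keys m. Poly_Mapping.lookup m i)"

definition Rcomp :: "nat \<Rightarrow> int \<Rightarrow> 'a::field mpoly set" where
  "Rcomp n d = {p. \<forall>m\<in>Poly_Mapping.keys p. Poly_Mapping.keys m \<subseteq> {..<n} \<and> int (mon_deg m) = d}"

definition vdim_poly :: "'a::field mpoly set \<Rightarrow> nat" where
  "vdim_poly V = vector_space.dim cscale V"

definition vdim_ext :: "(nat set \<Rightarrow> 'a::field mpoly) set \<Rightarrow> nat" where
  "vdim_ext V = vector_space.dim (\<lambda>c f. \<lambda>I. cscale c (f I)) V"

text \<open>An element of \<And>^k R^n is a family (f_I) indexed by k-subsets I of {0..<n},
  representing sum_I f_I e_I; e_I has degree k.  Its degree-d component consists of the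
  families with all f_I homogeneous of degree d - k.\<close>
definition ExtComp :: "nat \<Rightarrow> nat \<Rightarrow> int \<Rightarrow> (nat set \<Rightarrow> 'a::field mpoly) set" where
  "ExtComp n k d = {f. (\<forall>I. f I \<noteq> 0 \<longrightarrow> I \<subseteq> {..<n} \<and> card I = k)
                      \<and> (\<forall>I. f I \<in> Rcomp n (d - int k))}"

text \<open>Koszul differential: d(e_{i_1} .. e_{i_k}) = sum_r (-1)^(r+1) X_{i_r} e_{I - i_r}
  (i_1 < ... < i_k).  The coefficient of e_J in d(f) collects the I = J + {i}, i not in J,
  with sign (-1)^(number of elements of J below i).\<close>
definition koszul :: "nat \<Rightarrow> (nat set \<Rightarrow> 'a::field mpoly) \<Rightarrow> (nat set \<Rightarrow> 'a mpoly)" where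
  "koszul n f = (\<lambda>J. \<Sum>i\<in>{..<n} - J. (- 1) ^ card {j\<in>J. j < i} * Var i * f (insert i J))"

definition Mcomp :: "nat \<Rightarrow> nat \<Rightarrow> int \<Rightarrow> (nat set \<Rightarrow> 'a::field mpoly) set" where
  "Mcomp n k d = koszul n ` ExtComp n k d"

text \<open>Graded retract S = K[L] generated by a set L of linear forms of R.
  Its degree-j component is spanned by the products of j elements of L.\<close>
definition retract_comp :: "'a::field mpoly set \<Rightarrow> int \<Rightarrow> 'a mpoly set" where
  "retract_comp L j = (if j < 0 then {0}
      else module.span cscale {prod_list ls | ls. length ls = nat j \<and> set ls \<subseteq> L})"

text \<open>Krull dimension of the graded retract K[L] = number of algebraically independent
  generators = K-dimension of its space of linear forms span(L).\<close>
definition retract_dim :: "'a::field mpoly set \<Rightarrow> nat" where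
  "retract_dim L = vdim_poly L"

text \<open>Hilbert decomposition of M(n,k): a finite family (S_i, s_i) with
  M \<cong> \<Oplus> S_i(-s_i) as graded K-vector spaces, i.e. equal (finite) K-dimensions in
  every degree.\<close>
definition hilbert_decomp :: "'a itself \<Rightarrow> nat \<Rightarrow> nat \<Rightarrow> ('a::field mpoly set \<times> int) list \<Rightarrow> bool" where
  "hilbert_decomp _ n k D \<longleftrightarrow>
     (\<forall>(L, s)\<in>set D. L \<subseteq> Rcomp n 1) \<and>
     (\<forall>d::int. vdim_ext (Mcomp n k d :: (nat set \<Rightarrow> 'a mpoly) set)
                = (\<Sum>(L, s)\<leftarrow>D. vdim_poly (retract_comp L (d - s))))"

definition decomp_depth :: "('a::field mpoly set \<times> int) list \<Rightarrow> nat" where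
  "decomp_depth D = Min ((\<lambda>(L, s). retract_dim L) ` set D)"

definition Hdepth1 :: "'a::field itself \<Rightarrow> nat \<Rightarrow> nat \<Rightarrow> nat" where
  "Hdepth1 T n k = Max {decomp_depth D | D. D \<noteq> [] \<and> hilbert_decomp T n k D}"

definition selfpow :: "real \<Rightarrow> real" where
  "selfpow x = (if x = 0 then 1 else x powr x)"

definition alpha_of :: "real \<Rightarrow> real \<Rightarrow> real" where
  "alpha_of \<beta> \<gamma> = (1 - 2*\<beta> - 2*\<gamma> + sqrt ((1 - 2*\<beta> - 2*\<gamma>)\<^sup>2 - 8*\<beta>*\<gamma>)) / 4"

text \<open>\<gamma> is a nonnegative (real) solution of the equation: all quantities are real and all
  bases of the powers x^x are nonnegative, and the quotient equals 1.\<close>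
definition is_solution :: "real \<Rightarrow> real \<Rightarrow> bool" where
  "is_solution \<beta> \<gamma> \<longleftrightarrow> (let \<alpha> = alpha_of \<beta> \<gamma> in
     0 \<le> \<gamma> \<and> 0 \<le> (1 - 2*\<beta> - 2*\<gamma>)\<^sup>2 - 8*\<beta>*\<gamma> \<and>
     0 \<le> \<alpha> \<and> 0 \<le> \<beta> \<and> 0 \<le> \<alpha> + \<gamma> \<and> 0 \<le> \<alpha> + \<beta> \<and> 0 \<le> 1 - \<alpha> - \<beta> - \<gamma> \<and>
     0 \<le> 1 - \<beta> \<and> 0 \<le> 1 - \<gamma> \<and>
     (selfpow (\<alpha> + \<gamma>) * selfpow (\<alpha> + \<beta>) * selfpow (1 - \<alpha> - \<beta> - \<gamma>)) /
     (selfpow \<alpha> * selfpow \<beta> * selfpow \<gamma> * selfpow (1 - \<beta>) * selfpow (1 - \<gamma>)) = 1)"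

end

theory Submission
  imports Defs "HOL-Computational_Algebra.Formal_Power_Series" "HOL-Real_Asymp.Real_Asymp"
    "HOL-Analysis.Elementary_Metric_Spaces"
begin

text \<open>
  The module \<open>M(n,k)\<close> has a basis of images \<open>\<partial>(X\<^sup>a e\<^sub>I)\<close> with \<open>min I \<le> min supp a\<close>, whence its Hilbert
  series is \<open>\<Sum>\<^sub>l C(l-1,k-1) T\<^sup>k / (1-T)\<^sup>l\<close>. A Hilbert decomposition of depth at least \<open>n - s\<close>
  (\<open>s \<ge> 1\<close>) exists iff \<open>(1-T)\<^bsup>n-s\<^esup>\<close> times this series has no negative coefficient: far out, the
  coefficients and all their iterated differences are positive, so the tail is a nonnegative
  combination of the series \<open>T\<^sup>N / (1-T)\<^sup>j\<close>.

  The coefficient of degree \<open>k + m\<close> is an alternating sum with leading summand \<open>C(n,k) C(s+m-1,m)\<close>,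
  and it is also \<open>(-1)\<^sup>m C(n-s,k+m)\<close> plus an alternating sum with leading summand
  \<open>C(n,k-1) C(s+m,m+1)\<close>. For each \<open>m\<close> one of the two sums has decreasing summands, so up to
  polynomial factors the sign is decided by comparing \<open>C(n-s,k+m)\<close> with \<open>C(n,k) C(s+m,m)\<close>.
  With \<open>m = \<alpha>n\<close>, \<open>k = \<beta>n\<close>, \<open>s = \<gamma>n\<close> the exponential rate of their quotient is the logarithm of
  the given expression; it is increasing in \<open>\<gamma>\<close>, and at the solution \<open>\<gamma>\<close> its minimum over the
  \<open>\<alpha>\<close>-range is \<open>0\<close>, attained at the given root \<open>\<alpha>\<close> of the critical equation.
\<close>

section \<open>Monomials and biorthogonal families\<close>

text \<open>The two alternating sums exist because the numerator of the Hilbert series is, up to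
  sign, \<open>(1-T)^n\<close> with the terms of degree below \<open>k\<close> removed: one sums
  over the kept terms, the other over the removed ones. Neither list of summands need decrease for a
  given \<open>m\<close>, but failure of the criterion for the first yields the criterion for the
  second as soon as \<open>2k \<le> n + s\<close>, which \<open>\<beta> \<le> 1/2\<close> provides.
  Where the first list decreases, the coefficient is automatically nonnegative; elsewhere only odd
  \<open>m\<close> can do harm. The lower bound on the depth needs estimates uniform in
  \<open>m\<close>, whereas one odd \<open>m\<close> near \<open>\<alpha>n\<close> settles the upper
  bound. Uniformity comes from the derivative of the rate in \<open>\<gamma>\<close>: it is at least
  \<open>-ln (1-\<beta>)\<close> whatever the other arguments are, so moving \<open>\<gamma>\<close>
  by \<open>\<delta>\<close> gains an exponential factor that beats all polynomial losses. As such
  losses are harmless, binomial coefficients are estimated from the expansion of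
  \<open>(b + (a-b))^a\<close> instead of Stirling's formula.\<close>

text \<open>All dimension counts below go through dual functionals that read off a coefficient.
  Duality forces both injectivity of \<open>v\<close> and linear independence.\<close>

lemma (in vector_space) dim_span_biorthogonal:
  assumes "finite A"
    and add: "\<And>i x y. i \<in> A \<Longrightarrow> \<phi> i (x + y) = \<phi> i x + \<phi> i y"
    and scale: "\<And>i c x. i \<in> A \<Longrightarrow> \<phi> i (c *s x) = c * \<phi> i x"
    and dual: "\<And>i j. i \<in> A \<Longrightarrow> j \<in> A \<Longrightarrow> \<phi> i (v j) = (if i = j then 1 else 0)"
  shows "dim (span (v ` A)) = card A"
proof -
  have inj: "inj_on v A"
  proof (rule inj_onI)
    fix i j assume ij: "i \<in> A" "j \<in> A" "v i = v j"
    then show "i = j" using dual[of i i] dual[of i j] by (auto split: if_splits)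
  qed
  have zero: "\<phi> i 0 = 0" if "i \<in> A" for i
    using scale[OF that, of 0 0] by simp
  have \<phi>sum: "\<phi> i (\<Sum>x\<in>S. f x) = (\<Sum>x\<in>S. \<phi> i (f x))" if "i \<in> A" "finite S" for i S and f :: "'c \<Rightarrow> 'b"
    using that(2) by (induction S rule: finite_induct) (simp_all add: zero add that(1))
  have "independent (v ` A)"
  proof (rule independent_if_scalars_zero)
    fix f x assume eq: "(\<Sum>x\<in>v ` A. f x *s x) = 0" and "x \<in> v ` A"
    then obtain i where i: "i \<in> A" "x = v i" by auto
    have "0 = \<phi> i (\<Sum>j\<in>A. f (v j) *s v j)"
      using eq zero[OF i(1)] by (simp add: sum.reindex[OF inj])
    also have "\<dots> = (\<Sum>j\<in>A. f (v j) * (if i = j then 1 else 0))"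
      using i assms(1) by (simp add: \<phi>sum scale dual)
    also have "\<dots> = f x" using i assms(1) by (simp add: if_distrib sum.delta cong: if_cong)
    finally show "f x = 0" by simp
  qed (use assms(1) in auto)
  then show ?thesis
    by (metis dim_span_eq_card_independent card_image inj)
qed

lemma lookup_cscale [simp]:
  "Poly_Mapping.lookup (cscale c p) m = c * Poly_Mapping.lookup p m"
  by (simp add: cscale_def flip: mult_map_scale_conv_mult) (simp add: Poly_Mapping.map.rep_eq when_def)

lemma vector_space_cscale: "vector_space cscale"
  by unfold_locales (auto intro!: poly_mapping_eqI simp: lookup_add algebra_simps)

global_interpretation poly: vector_space "cscale :: 'a::field \<Rightarrow> 'a mpoly \<Rightarrow> 'a mpoly"
  by (rule vector_space_cscale)

global_interpretation ext: vector_space "\<lambda>(c::'a::field) f I. cscale c (f I :: 'a mpoly)"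
  by unfold_locales
    (simp_all add: fun_eq_iff poly.scale_right_distrib poly.scale_left_distrib)

lemma cscale_mult_left: "cscale c p * q = cscale c (p * q)"
  by (simp add: cscale_def mult.assoc)

lemma cscale_mult_right: "p * cscale c q = cscale c (p * q)"
  by (simp add: cscale_def mult.left_commute)

lemma mon_deg_add: "mon_deg (a + b) = mon_deg a + mon_deg b"
  unfolding mon_deg_def by (rule setsum_keys_plus_distrib) simp_all

lemma mon_deg_single [simp]: "mon_deg (Poly_Mapping.single i c) = c"
  by (simp add: mon_deg_def)

lemma mon_deg_0 [simp]: "mon_deg 0 = 0"
  by (simp add: mon_deg_def)

lemma mon_deg_eq_0_iff: "mon_deg a = 0 \<longleftrightarrow> a = 0"
proof
  assume "mon_deg a = 0"
  then have "\<forall>i\<in>Poly_Mapping.keys a. Poly_Mapping.lookup a i = 0" by (simp add: mon_deg_def)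
  then show "a = 0" by (auto intro!: poly_mapping_eqI simp: in_keys_iff)
qed simp

lemma keys_add_nat: "Poly_Mapping.keys (a + b) = Poly_Mapping.keys a \<union> Poly_Mapping.keys b"
  for a b :: "'b \<Rightarrow>\<^sub>0 nat"
  by (auto simp: in_keys_iff lookup_add)

lemma single_add_diff:
  fixes a :: "nat \<Rightarrow>\<^sub>0 nat"
  assumes "x \<in> Poly_Mapping.keys a"
  shows "Poly_Mapping.single x 1 + (a - Poly_Mapping.single x 1) = a"
  using assms by (auto intro!: poly_mapping_eqI
      simp: lookup_add lookup_minus lookup_single in_keys_iff when_def)

definition Mons :: "nat set \<Rightarrow> nat \<Rightarrow> (nat \<Rightarrow>\<^sub>0 nat) set" where
  "Mons P j = {a. Poly_Mapping.keys a \<subseteq> P \<and> mon_deg a = j}"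

lemma Mons_0: "Mons P 0 = {0}"
  by (auto simp: Mons_def mon_deg_eq_0_iff)

lemma Mons_insert_Suc:
  "Mons (insert x P) (Suc j) =
     Mons P (Suc j) \<union> (\<lambda>a. Poly_Mapping.single x 1 + a) ` Mons (insert x P) j"
  if "x \<notin> P"
proof (intro set_eqI iffI)
  fix a assume a: "a \<in> Mons (insert x P) (Suc j)"
  show "a \<in> Mons P (Suc j) \<union> (\<lambda>a. Poly_Mapping.single x 1 + a) ` Mons (insert x P) j"
  proof (cases "x \<in> Poly_Mapping.keys a")
    case False
    then show ?thesis using a that by (auto simp: Mons_def)
  next
    case True
    define b where "b = a - Poly_Mapping.single x 1"
    have ab: "a = Poly_Mapping.single x 1 + b" using single_add_diff[OF True] b_def by simp
    then have "b \<in> Mons (insert x P) j"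
      using a by (auto simp: Mons_def keys_add_nat mon_deg_add)
    then show ?thesis using ab by blast
  qed
next
  fix a assume "a \<in> Mons P (Suc j) \<union> (\<lambda>a. Poly_Mapping.single x 1 + a) ` Mons (insert x P) j"
  then show "a \<in> Mons (insert x P) (Suc j)"
    using that by (auto simp: Mons_def keys_add_nat mon_deg_add)
qed

text \<open>Splitting by divisibility by the new variable gives Pascal's rule. Truncated subtraction
  makes the formula right for empty \<open>P\<close> as well: it gives 1 for \<open>j = 0\<close>
  and 0 otherwise.\<close>

lemma finite_card_Mons:
  assumes "finite P"
  shows "finite (Mons P j) \<and> card (Mons P j) = (card P + j - 1) choose j"
  using assms
proof (induction P arbitrary: j rule: finite_induct)
  case empty
  have "Mons {} j = (if j = 0 then {0} else {})"
    by (auto simp: Mons_def in_keys_iff intro!: poly_mapping_eqI)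
  then show ?case by (cases j) auto
next
  case (insert x P)
  show ?case
  proof (induction j)
    case 0
    then show ?case by (simp add: Mons_0)
  next
    case (Suc j)
    have disj: "Mons P (Suc j) \<inter> (\<lambda>a. Poly_Mapping.single x 1 + a) ` Mons (insert x P) j = {}"
      using insert.hyps by (auto simp: Mons_def keys_add_nat)
    have inj: "inj_on (\<lambda>a. Poly_Mapping.single x 1 + a) (Mons (insert x P) j)"
      by (auto simp: inj_on_def)
    have "card (Mons (insert x P) (Suc j)) = ((card P + Suc j - 1) choose Suc j) + ((card (insert x P) + j - 1) choose j)"
      using insert.hyps insert.IH[of "Suc j"] Suc
      unfolding Mons_insert_Suc[OF insert.hyps(2)]
      by (subst card_Un_disjoint[OF _ _ disj]) (simp_all add: card_image)
    moreover have "finite (Mons (insert x P) (Suc j))"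
      using insert.hyps insert.IH[of "Suc j"] Suc by (simp add: Mons_insert_Suc)
    ultimately show ?case using insert.hyps by simp
  qed
qed

lemma finite_Mons: "finite P \<Longrightarrow> finite (Mons P j)"
  and card_Mons: "finite P \<Longrightarrow> card (Mons P j) = (card P + j - 1) choose j"
  using finite_card_Mons by blast+

section \<open>Graded retracts\<close>

lemma ex_key_if_nonzero: "p \<noteq> 0 \<Longrightarrow> \<exists>m. m \<in> Poly_Mapping.keys p"
  by (metis in_keys_iff lookup_zero poly_mapping_eqI)

lemma mon_deg_eq_1D:
  assumes "mon_deg m = 1"
  obtains i where "m = Poly_Mapping.single i 1"
proof -
  have "m \<noteq> 0" using assms by auto
  then obtain i where i: "i \<in> Poly_Mapping.keys m" using ex_key_if_nonzero by blast
  have "mon_deg (Poly_Mapping.single i 1 + (m - Poly_Mapping.single i 1)) = 1"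
    using single_add_diff[OF i] assms by simp
  then have "m - Poly_Mapping.single i 1 = 0"
    by (simp add: mon_deg_add mon_deg_eq_0_iff)
  then have "m = Poly_Mapping.single i 1" using single_add_diff[OF i] by simp
  then show ?thesis by (rule that)
qed

lemma single_1_eq_iff:
  "Poly_Mapping.single i (1::nat) = Poly_Mapping.single j 1 \<longleftrightarrow> i = j"
  by (metis keys_single one_neq_zero singleton_inject)

lemma subspace_Rcomp: "poly.subspace (Rcomp n d :: 'a::field mpoly set)"
proof (rule poly.subspaceI)
  show "0 \<in> Rcomp n d" by (simp add: Rcomp_def)
next
  fix x y :: "'a mpoly" assume "x \<in> Rcomp n d" "y \<in> Rcomp n d"
  then show "x + y \<in> Rcomp n d" using keys_add[of x y] by (auto simp: Rcomp_def)
next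
  fix c and x :: "'a mpoly" assume "x \<in> Rcomp n d"
  moreover have "Poly_Mapping.keys (cscale c x) \<subseteq> Poly_Mapping.keys x"
    by (auto simp: in_keys_iff)
  ultimately show "cscale c x \<in> Rcomp n d" by (auto simp: Rcomp_def)
qed

lemma linear_form_eq_0:
  assumes "p \<in> Rcomp n 1" and "\<And>i. i < n \<Longrightarrow> Poly_Mapping.lookup p (Poly_Mapping.single i 1) = 0"
  shows "p = 0"
proof (rule ccontr)
  assume "p \<noteq> 0"
  then obtain m where m: "m \<in> Poly_Mapping.keys p" using ex_key_if_nonzero by blast
  then have deg: "mon_deg m = 1" and keys: "Poly_Mapping.keys m \<subseteq> {..<n}"
    using assms(1) by (auto simp: Rcomp_def)
  obtain i where i: "m = Poly_Mapping.single i 1" using deg by (rule mon_deg_eq_1D)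
  then have "i < n" using keys by simp
  then show False using assms(2)[of i] m i by (simp add: in_keys_iff)
qed

text \<open>The pivots of a reduced echelon basis: a minimal set of variables on which the coefficient
  functionals separate the points of the space.\<close>
lemma linear_forms_echelon_basis:
  fixes V :: "'a::field mpoly set"
  assumes V: "poly.subspace V" "V \<subseteq> Rcomp n 1"
  obtains P l where "P \<subseteq> {..<n}" "V = poly.span (l ` P)" "l ` P \<subseteq> V"
    "\<And>c c'. c \<in> P \<Longrightarrow> c' \<in> P \<Longrightarrow>
       Poly_Mapping.lookup (l c) (Poly_Mapping.single c' 1) = (if c' = c then 1 else 0)"
proof -
  let ?cf = "\<lambda>i (v::'a mpoly). Poly_Mapping.lookup v (Poly_Mapping.single i 1)"
  let ?sep = "\<lambda>P. P \<subseteq> {..<n} \<and> (\<forall>v\<in>V. (\<forall>i\<in>P. ?cf i v = 0) \<longrightarrow> v = 0)"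
  have "?sep {..<n}" using V(2) linear_form_eq_0 by blast
  then obtain P where P: "?sep P" and min: "\<And>P'. ?sep P' \<Longrightarrow> card P \<le> card P'"
    using ex_has_least_nat[of ?sep "{..<n}" card] by blast
  have finP: "finite P" using P finite_subset by blast
  have "\<exists>v\<in>V. ?cf c v = 1 \<and> (\<forall>i\<in>P - {c}. ?cf i v = 0)" if c: "c \<in> P" for c
  proof -
    have "card (P - {c}) < card P" using c finP by (intro psubset_card_mono) auto
    then have "\<not> ?sep (P - {c})" using min[of "P - {c}"] by linarith
    then obtain v where v: "v \<in> V" "\<forall>i\<in>P - {c}. ?cf i v = 0" "v \<noteq> 0" using P by auto
    then have nz: "?cf c v \<noteq> 0" using P by auto
    let ?w = "cscale (inverse (?cf c v)) v"
    have "?w \<in> V" using v(1) V(1) poly.subspace_scale by blast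
    moreover have "?cf c ?w = 1" "\<forall>i\<in>P - {c}. ?cf i ?w = 0" using nz v(2) by simp_all
    ultimately show ?thesis by blast
  qed
  then obtain l where l: "\<And>c. c \<in> P \<Longrightarrow> l c \<in> V \<and> ?cf c (l c) = 1 \<and> (\<forall>i\<in>P - {c}. ?cf i (l c) = 0)"
    by metis
  have lV: "l ` P \<subseteq> V" using l by auto
  have dual: "?cf c' (l c) = (if c' = c then 1 else 0)" if "c \<in> P" "c' \<in> P" for c c'
    using l[OF that(1)] that(2) by auto
  have "V \<subseteq> poly.span (l ` P)"
  proof
    fix v assume v: "v \<in> V"
    let ?w = "\<Sum>c\<in>P. cscale (?cf c v) (l c)"
    have wV: "?w \<in> V" using lV V(1) by (intro poly.subspace_sum poly.subspace_scale) auto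
    have "?cf i (v - ?w) = 0" if i: "i \<in> P" for i
    proof -
      have "?cf i ?w = (\<Sum>c\<in>P. ?cf c v * (if i = c then 1 else 0))"
        using i dual by (simp add: lookup_sum del: One_nat_def)
      also have "\<dots> = ?cf i v" using i finP by (simp add: if_distrib sum.delta cong: if_cong)
      finally show ?thesis by (simp add: lookup_minus)
    qed
    moreover have "v - ?w \<in> V" using v wV V(1) poly.subspace_diff by blast
    ultimately have "v - ?w = 0" using P by blast
    then have "v = ?w" by simp
    then show "v \<in> poly.span (l ` P)"
      by (metis (no_types, lifting) image_eqI poly.span_base poly.span_scale poly.span_sum)
  qed
  moreover have "poly.span (l ` P) \<subseteq> V" using lV V(1) poly.span_minimal by blast
  ultimately show ?thesis using that[of P l] P lV dual by blast
qed

text \<open>If \<open>m + x\<close> is supported in \<open>P\<close>, so are \<open>m\<close> and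
  \<open>x\<close>. Hence these coefficients are those of the images under the ring homomorphism
  that sets the variables outside \<open>P\<close> to zero.\<close>

lemma lookup_mult_cong_supported:
  fixes p q p' q' :: "'a::field mpoly"
  assumes "\<And>b. Poly_Mapping.keys b \<subseteq> P \<Longrightarrow> Poly_Mapping.lookup p b = Poly_Mapping.lookup p' b"
    and "\<And>b. Poly_Mapping.keys b \<subseteq> P \<Longrightarrow> Poly_Mapping.lookup q b = Poly_Mapping.lookup q' b"
    and b: "Poly_Mapping.keys b \<subseteq> P"
  shows "Poly_Mapping.lookup (p * q) b = Poly_Mapping.lookup (p' * q') b"
proof -
  have inner: "Sum_any (\<lambda>x. Poly_Mapping.lookup q x when b = m + x) = Sum_any (\<lambda>x. Poly_Mapping.lookup q' x when b = m + x)" for m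
    using assms(2) b by (intro Sum_any.cong) (auto simp: when_def keys_add_nat)
  have inner0: "Sum_any (\<lambda>x. Poly_Mapping.lookup q' x when b = m + x) = 0" if "\<not> Poly_Mapping.keys m \<subseteq> P" for m
  proof -
    have "(Poly_Mapping.lookup q' x when b = m + x) = 0" for x
      using that b by (auto simp: when_def keys_add_nat)
    then show ?thesis by simp
  qed
  show ?thesis
    unfolding lookup_mult inner
  proof (rule Sum_any.cong)
    fix m
    show "Poly_Mapping.lookup p m * Sum_any (\<lambda>x. Poly_Mapping.lookup q' x when b = m + x)
        = Poly_Mapping.lookup p' m * Sum_any (\<lambda>x. Poly_Mapping.lookup q' x when b = m + x)"
      by (cases "Poly_Mapping.keys m \<subseteq> P") (simp_all add: assms(1) inner0)
  qed
qed

definition monom_of :: "(nat \<Rightarrow> 'a::field mpoly) \<Rightarrow> nat set \<Rightarrow> (nat \<Rightarrow>\<^sub>0 nat) \<Rightarrow> 'a mpoly" where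
  "monom_of l P a = (\<Prod>c\<in>P. l c ^ Poly_Mapping.lookup a c)"

lemma monom_of_Var:
  assumes "finite P" "Poly_Mapping.keys a \<subseteq> P"
  shows "monom_of Var P a = (Poly_Mapping.single a 1 :: 'a::field mpoly)"
proof -
  have pow: "(Var c :: 'a mpoly) ^ j = Poly_Mapping.single (Poly_Mapping.single c j) 1" for c j
    by (induction j) (simp_all add: Var_def mult_single flip: single_add)
  have "(\<Prod>c\<in>Q. Poly_Mapping.single (f c) (1::'a)) = Poly_Mapping.single (\<Sum>c\<in>Q. f c) 1"
    if "finite Q" for Q and f :: "nat \<Rightarrow> nat \<Rightarrow>\<^sub>0 nat"
    using that by (induction Q rule: finite_induct) (simp_all add: mult_single)
  moreover have "(\<Sum>c\<in>P. Poly_Mapping.single c (Poly_Mapping.lookup a c)) = a"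
  proof (rule poly_mapping_eqI)
    fix x
    have "x \<notin> P \<Longrightarrow> Poly_Mapping.lookup a x = 0" using assms(2) by (auto simp: in_keys_iff)
    then show "Poly_Mapping.lookup (\<Sum>c\<in>P. Poly_Mapping.single c (Poly_Mapping.lookup a c)) x = Poly_Mapping.lookup a x"
      using assms(1) by (auto simp: lookup_sum lookup_single when_def)
  qed
  ultimately show ?thesis using assms(1) by (simp add: monom_of_def pow)
qed

text \<open>Setting the variables outside \<open>P\<close> to zero turns each \<open>l c\<close>
  into the variable with index \<open>c\<close>, and so turns a monomial in the forms
  \<open>l\<close> into the same monomial in the variables. This is the algebraic independence of an
  echelon basis, in dual form.\<close>

lemma lookup_monom_of:
  assumes "finite P" and l: "\<And>c. c \<in> P \<Longrightarrow> l c \<in> Rcomp n 1"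
    and dual: "\<And>c c'. c \<in> P \<Longrightarrow> c' \<in> P \<Longrightarrow>
       Poly_Mapping.lookup (l c) (Poly_Mapping.single c' 1) = (if c' = c then 1 else (0::'a::field))"
    and a: "Poly_Mapping.keys a \<subseteq> P" and b: "Poly_Mapping.keys b \<subseteq> P"
  shows "Poly_Mapping.lookup (monom_of l P a) b = (if b = a then 1 else 0)"
proof -
  have base: "Poly_Mapping.lookup (l c) m = Poly_Mapping.lookup (Var c) m"
    if c: "c \<in> P" and m: "Poly_Mapping.keys m \<subseteq> P" for c m
  proof (cases "mon_deg m = 1")
    case True
    then obtain i where i: "m = Poly_Mapping.single i 1" by (rule mon_deg_eq_1D)
    then show ?thesis using m dual[OF c, of i] by (auto simp: Var_def lookup_single when_def simp flip: One_nat_def simp add: single_1_eq_iff)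
  next
    case False
    then have "m \<notin> Poly_Mapping.keys (l c)" using l[OF c] by (auto simp: Rcomp_def)
    moreover have "m \<noteq> Poly_Mapping.single c 1" using False by auto
    ultimately show ?thesis by (auto simp: in_keys_iff Var_def lookup_single when_def)
  qed
  have pow: "Poly_Mapping.lookup (l c ^ j) m = Poly_Mapping.lookup (Var c ^ j) m"
    if c: "c \<in> P" and m: "Poly_Mapping.keys m \<subseteq> P" for c j m
    using m
  proof (induction j arbitrary: m)
    case (Suc j)
    then show ?case using base[OF c] by (auto intro: lookup_mult_cong_supported[where P = P])
  qed simp
  have prods: "Poly_Mapping.lookup (\<Prod>c\<in>Q. l c ^ Poly_Mapping.lookup a c) m
      = Poly_Mapping.lookup (\<Prod>c\<in>Q. Var c ^ Poly_Mapping.lookup a c) m"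
    if "finite Q" "Q \<subseteq> P" "Poly_Mapping.keys m \<subseteq> P" for Q m
    using that
  proof (induction Q arbitrary: m rule: finite_induct)
    case (insert x Q)
    then show ?case using pow by (simp, intro lookup_mult_cong_supported[where P = P]) auto
  qed simp
  have "Poly_Mapping.lookup (monom_of l P a) b = Poly_Mapping.lookup (monom_of Var P a) b"
    using prods[OF assms(1) subset_refl b] by (simp add: monom_of_def)
  then show ?thesis
    by (auto simp: monom_of_Var[OF assms(1) a] lookup_single when_def)
qed

definition products :: "'a::field mpoly set \<Rightarrow> nat \<Rightarrow> 'a mpoly set" where
  "products L j = {prod_list ls | ls. length ls = j \<and> set ls \<subseteq> L}"

lemma products_Suc: "products L (Suc j) = {x * y | x y. x \<in> L \<and> y \<in> products L j}"
  unfolding products_def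
proof (intro set_eqI iffI)
  fix z assume "z \<in> {prod_list ls |ls. length ls = Suc j \<and> set ls \<subseteq> L}"
  then obtain ls where "z = prod_list ls" "length ls = Suc j" "set ls \<subseteq> L" by auto
  then show "z \<in> {x * y |x y. x \<in> L \<and> y \<in> {prod_list ls |ls. length ls = j \<and> set ls \<subseteq> L}}"
    by (cases ls) auto
next
  fix z assume "z \<in> {x * y |x y. x \<in> L \<and> y \<in> {prod_list ls |ls. length ls = j \<and> set ls \<subseteq> L}}"
  then obtain x ls where "z = prod_list (x # ls)" "length (x # ls) = Suc j" "set (x # ls) \<subseteq> L" by auto
  then show "z \<in> {prod_list ls |ls. length ls = Suc j \<and> set ls \<subseteq> L}" by blast
qed

text \<open>By bilinearity, each degree of \<open>K[L]\<close> depends only on the span of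
  \<open>L\<close>; this permits replacing \<open>L\<close> by an echelon basis.\<close>

lemma products_span_mono:
  assumes "L \<subseteq> poly.span L'"
  shows "products L j \<subseteq> poly.span (products L' j)"
proof (induction j)
  case 0
  then show ?case using poly.span_base[of 1 "products L' 0"] by (auto simp: products_def)
next
  case (Suc j)
  have mult: "x * y \<in> poly.span (products L' (Suc j))"
    if x: "x \<in> poly.span L'" and y: "y \<in> poly.span (products L' j)" for x y
    using x
  proof (induction rule: poly.span_induct_alt)
    case (step c u v)
    have "u * y \<in> poly.span (products L' (Suc j))"
      using y
    proof (induction rule: poly.span_induct_alt)
      case (step d s t)
      have "u * s \<in> products L' (Suc j)"
        using step.hyps \<open>u \<in> L'\<close> by (auto simp: products_Suc)
      then show ?case using step.IH
        by (simp add: distrib_left cscale_mult_right poly.span_add poly.span_scale poly.span_base)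
    qed (simp add: poly.span_zero)
    then show ?case using step.IH
      by (simp add: distrib_right cscale_mult_left poly.span_add poly.span_scale)
  qed (simp add: poly.span_zero)
  show ?case
    using Suc assms by (auto simp: products_Suc[of L] intro!: mult)
qed

lemma products_eq_monom_of:
  assumes "finite P"
  shows "products (l ` P) j = monom_of l P ` Mons P j"
proof (induction j)
  case 0
  then show ?case by (simp add: products_def Mons_0 monom_of_def)
next
  case (Suc j)
  have shift: "l c * monom_of l P a = monom_of l P (Poly_Mapping.single c 1 + a)" if "c \<in> P" for c a
  proof -
    have "monom_of l P (Poly_Mapping.single c 1 + a)
        = (\<Prod>x\<in>P. l x ^ (if x = c then 1 else 0)) * monom_of l P a"
      by (auto simp: monom_of_def lookup_add lookup_single when_def power_add
          simp flip: prod.distrib intro!: prod.cong)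
    also have "(\<Prod>x\<in>P. l x ^ (if x = c then 1 else 0)) = (\<Prod>x\<in>P. if x = c then l x else 1)"
      by (intro prod.cong) auto
    also have "\<dots> = l c" using assms that by simp
    finally show ?thesis by simp
  qed
  show ?case
  proof (intro set_eqI iffI)
    fix z assume "z \<in> products (l ` P) (Suc j)"
    then obtain c a where ca: "c \<in> P" "a \<in> Mons P j" "z = l c * monom_of l P a"
      by (auto simp: products_Suc Suc)
    then have "Poly_Mapping.single c 1 + a \<in> Mons P (Suc j)"
      by (auto simp: Mons_def keys_add_nat mon_deg_add)
    then show "z \<in> monom_of l P ` Mons P (Suc j)" using ca shift by auto
  next
    fix z assume "z \<in> monom_of l P ` Mons P (Suc j)"
    then obtain a where a: "a \<in> Mons P (Suc j)" "z = monom_of l P a" by auto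
    then have "a \<noteq> 0" by (auto simp: Mons_def)
    then obtain c where c: "c \<in> Poly_Mapping.keys a" using ex_key_if_nonzero by blast
    define b where "b = a - Poly_Mapping.single c 1"
    have ab: "a = Poly_Mapping.single c 1 + b" using single_add_diff[OF c] b_def by simp
    have cP: "c \<in> P" using a c by (auto simp: Mons_def)
    have "b \<in> Mons P j" using a(1) unfolding ab by (auto simp: Mons_def keys_add_nat mon_deg_add)
    moreover have "z = l c * monom_of l P b" using a(2) ab shift[OF cP] by simp
    ultimately show "z \<in> products (l ` P) (Suc j)"
      unfolding products_Suc Suc using cP by blast
  qed
qed

lemma retract_comp_nonneg: "retract_comp L (int j) = poly.span (products L j)"
  by (simp add: retract_comp_def products_def)

lemma retract_comp_neg:
  fixes L :: "'a::field mpoly set"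
  assumes "d < 0"
  shows "vdim_poly (retract_comp L d) = 0"
  using assms poly.dim_span[of "{} :: 'a mpoly set"]
    poly.dim_eq_card_independent[OF poly.independent_empty, where ?'a = 'a]
  by (simp add: retract_comp_def vdim_poly_def)

text \<open>With an echelon basis as generators, \<open>K[L]\<close> is a polynomial ring on the
  pivots \<open>P\<close>: the monomials in the basis form a basis of each degree, so exponent
  vectors on \<open>P\<close> are counted.\<close>

lemma retract_dims:
  fixes L :: "'a::field mpoly set"
  assumes "L \<subseteq> Rcomp n 1"
  shows vdim_retract_comp: "vdim_poly (retract_comp L (int j)) = (retract_dim L + j - 1) choose j"
    and retract_dim_le: "retract_dim L \<le> n"
proof -
  have "poly.span L \<subseteq> Rcomp n 1" using assms subspace_Rcomp poly.span_minimal by blast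
  then obtain P l where P: "P \<subseteq> {..<n}" and span: "poly.span L = poly.span (l ` P)"
    and lV: "l ` P \<subseteq> poly.span L"
    and dual: "\<And>c c'. c \<in> P \<Longrightarrow> c' \<in> P \<Longrightarrow>
       Poly_Mapping.lookup (l c) (Poly_Mapping.single c' 1) = (if c' = c then 1 else 0)"
    by (rule linear_forms_echelon_basis[OF poly.subspace_span]) blast
  have finP: "finite P" using P finite_subset by blast
  have lin: "\<And>c. c \<in> P \<Longrightarrow> l c \<in> Rcomp n 1" using lV \<open>poly.span L \<subseteq> Rcomp n 1\<close> by blast
  have "poly.dim (poly.span (l ` P)) = card P"
    by (rule poly.dim_span_biorthogonal[where \<phi> = "\<lambda>c p. Poly_Mapping.lookup p (Poly_Mapping.single c 1)"])
      (use finP dual in \<open>auto simp: lookup_add\<close>)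
  then have dimL: "retract_dim L = card P"
    unfolding retract_dim_def vdim_poly_def by (metis span poly.dim_span)
  then show "retract_dim L \<le> n" using card_mono[OF _ P] by simp
  have "poly.span (products L j) = poly.span (products (l ` P) j)"
    unfolding poly.span_eq
    using products_span_mono[of L "l ` P" j] products_span_mono[of "l ` P" L j] span lV
      poly.span_superset[of L] by auto
  also have "poly.dim \<dots> = card (Mons P j)"
    unfolding products_eq_monom_of[OF finP]
  proof (rule poly.dim_span_biorthogonal[where \<phi> = "\<lambda>a p. Poly_Mapping.lookup p a"])
    show "finite (Mons P j)" using finite_Mons[OF finP] .
    fix a b assume "a \<in> Mons P j" "b \<in> Mons P j"
    then show "Poly_Mapping.lookup (monom_of l P b) a = (if a = b then 1 else 0)"
      using lookup_monom_of[OF finP lin dual] by (auto simp: Mons_def)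
  qed (simp_all add: lookup_add)
  finally show "vdim_poly (retract_comp L (int j)) = (retract_dim L + j - 1) choose j"
    by (simp add: vdim_poly_def retract_comp_nonneg card_Mons[OF finP] dimL)
qed

text \<open>Supplies a retract of each dimension up to \<open>n\<close> when a decomposition has to
  be built from numerical data.\<close>

lemma Var_retract:
  assumes "p \<le> n"
  shows "Var ` {..<p} \<subseteq> (Rcomp n 1 :: 'a::field mpoly set)"
    and "retract_dim (Var ` {..<p} :: 'a mpoly set) = p"
proof -
  show "Var ` {..<p} \<subseteq> (Rcomp n 1 :: 'a mpoly set)"
    using assms by (auto simp: Rcomp_def Var_def)
  have "poly.dim (poly.span (Var ` {..<p} :: 'a mpoly set)) = card {..<p}"
    by (rule poly.dim_span_biorthogonal[where \<phi> = "\<lambda>c p. Poly_Mapping.lookup p (Poly_Mapping.single c 1)"])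
      (auto simp: lookup_add Var_def lookup_single when_def simp flip: One_nat_def simp add: single_1_eq_iff)
  then show "retract_dim (Var ` {..<p} :: 'a mpoly set) = p"
    by (simp add: retract_dim_def vdim_poly_def)
qed

section \<open>The Koszul syzygies\<close>

abbreviation ext_scale :: "'a::field \<Rightarrow> (nat set \<Rightarrow> 'a mpoly) \<Rightarrow> nat set \<Rightarrow> 'a mpoly" where
  "ext_scale \<equiv> \<lambda>c f I. cscale c (f I)"

text \<open>The element \<open>X^a e_I\<close>, as a family supported at the single index set
  \<open>I\<close>.\<close>

definition ext_basis :: "nat set \<times> (nat \<Rightarrow>\<^sub>0 nat) \<Rightarrow> nat set \<Rightarrow> 'a::field mpoly" where
  "ext_basis = (\<lambda>(I, a) J. if J = I then Poly_Mapping.single a 1 else 0)"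

text \<open>Here \<open>j\<close> is the degree of the monomial alone; since \<open>e_I\<close> has
  degree \<open>k\<close>, the total degree is \<open>k + j\<close>.\<close>

definition ext_index :: "nat \<Rightarrow> nat \<Rightarrow> nat \<Rightarrow> (nat set \<times> (nat \<Rightarrow>\<^sub>0 nat)) set" where
  "ext_index n k j = {I. I \<subseteq> {..<n} \<and> card I = k} \<times> Mons {..<n} j"

lemma sum_fun_apply: "(\<Sum>x\<in>A. f x) y = (\<Sum>x\<in>A. f x y)"
  for f :: "'c \<Rightarrow> 'd \<Rightarrow> 'e::comm_monoid_add"
  by (induction A rule: infinite_finite_induct) auto

lemma finite_ext_index: "finite (ext_index n k j)"
proof -
  have "finite {I. I \<subseteq> {..<n} \<and> card I = k}"
    by (rule finite_subset[of _ "Pow {..<n}"]) auto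
  then show ?thesis by (simp add: ext_index_def finite_Mons)
qed

lemma subspace_ExtComp: "ext.subspace (ExtComp n k d :: (nat set \<Rightarrow> 'a::field mpoly) set)"
proof (rule ext.subspaceI)
  show "0 \<in> ExtComp n k d"
    by (simp add: ExtComp_def Rcomp_def)
next
  fix f g :: "nat set \<Rightarrow> 'a mpoly" assume fg: "f \<in> ExtComp n k d" "g \<in> ExtComp n k d"
  have "f I \<noteq> 0 \<or> g I \<noteq> 0" if "(f + g) I \<noteq> 0" for I
    using that by auto
  moreover have "f I + g I \<in> Rcomp n (d - int k)" for I
    using fg by (intro poly.subspace_add[OF subspace_Rcomp]) (simp_all add: ExtComp_def)
  ultimately show "f + g \<in> ExtComp n k d"
    using fg unfolding ExtComp_def plus_fun_apply mem_Collect_eq by blast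
next
  fix c and f :: "nat set \<Rightarrow> 'a mpoly" assume "f \<in> ExtComp n k d"
  then show "ext_scale c f \<in> ExtComp n k d"
    by (auto simp: ExtComp_def intro: poly.subspace_scale[OF subspace_Rcomp])
qed

lemma ExtComp_eq_span:
  "ExtComp n k (int (k + j)) = ext.span (ext_basis ` ext_index n k j :: (nat set \<Rightarrow> 'a::field mpoly) set)"
proof
  show "ext.span (ext_basis ` ext_index n k j) \<subseteq> (ExtComp n k (int (k + j)) :: (nat set \<Rightarrow> 'a mpoly) set)"
  proof (rule ext.span_minimal[OF _ subspace_ExtComp], rule image_subsetI)
    fix x assume "x \<in> ext_index n k j"
    then show "(ext_basis x :: nat set \<Rightarrow> 'a mpoly) \<in> ExtComp n k (int (k + j))"
      by (cases x) (auto simp: ext_basis_def ext_index_def ExtComp_def Rcomp_def Mons_def split: if_splits)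
  qed
  show "(ExtComp n k (int (k + j)) :: (nat set \<Rightarrow> 'a mpoly) set) \<subseteq> ext.span (ext_basis ` ext_index n k j)"
  proof
    fix f :: "nat set \<Rightarrow> 'a mpoly" assume f: "f \<in> ExtComp n k (int (k + j))"
    let ?c = "\<lambda>x. Poly_Mapping.lookup (f (fst x)) (snd x)"
    have "f = (\<Sum>x\<in>ext_index n k j. ext_scale (?c x) (ext_basis x))"
    proof (intro ext poly_mapping_eqI)
      fix J m
      have "Poly_Mapping.lookup ((\<Sum>x\<in>ext_index n k j. ext_scale (?c x) (ext_basis x)) J) m
          = (\<Sum>x\<in>ext_index n k j. ?c x * (if x = (J, m) then 1 else 0))"
        unfolding sum_fun_apply lookup_sum
        by (intro sum.cong) (auto simp: ext_basis_def lookup_single when_def split: prod.splits)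
      also have "\<dots> = (if (J, m) \<in> ext_index n k j then Poly_Mapping.lookup (f J) m else 0)"
        using finite_ext_index by (simp add: if_distrib sum.delta cong: if_cong)
      also have "\<dots> = Poly_Mapping.lookup (f J) m"
      proof (cases "Poly_Mapping.lookup (f J) m = 0")
        case False
        then have "f J \<noteq> 0" "m \<in> Poly_Mapping.keys (f J)" by (auto simp: in_keys_iff)
        then have "(J, m) \<in> ext_index n k j"
          using f by (fastforce simp: ext_index_def ExtComp_def Rcomp_def Mons_def)
        then show ?thesis by simp
      qed simp
      finally show "Poly_Mapping.lookup (f J) m
        = Poly_Mapping.lookup ((\<Sum>x\<in>ext_index n k j. ext_scale (?c x) (ext_basis x)) J) m" by simp
    qed
    moreover have "(\<Sum>x\<in>ext_index n k j. ext_scale (?c x) (ext_basis x)) \<in> ext.span (ext_basis ` ext_index n k j)"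
      by (intro ext.span_sum ext.span_scale ext.span_base) auto
    ultimately show "f \<in> ext.span (ext_basis ` ext_index n k j)" by simp
  qed
qed

lemma module_hom_koszul:
  "module_hom ext_scale ext_scale (koszul n :: (nat set \<Rightarrow> 'a::field mpoly) \<Rightarrow> _)"
  by unfold_locales
    (simp_all add: koszul_def fun_eq_iff distrib_left sum.distrib cscale_mult_right
      poly.scale_sum_right)

lemma koszul_koszul:
  fixes f :: "nat set \<Rightarrow> 'a::field mpoly"
  shows "koszul n (koszul n f) = 0"
proof
  fix J
  let ?s = "\<lambda>i J. (- 1 :: 'a mpoly) ^ card {j\<in>J. j < i}"
  let ?g = "\<lambda>(i, l). ?s i J * Var i * (?s l (insert i J) * Var l * f (insert l (insert i J)))"
  let ?A = "{(i, l). i < l \<and> l < n \<and> i \<notin> J \<and> l \<notin> J}"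
  let ?B = "{(i, l). l < i \<and> i < n \<and> i \<notin> J \<and> l \<notin> J}"
  have fin: "finite ?A" "finite ?B"
    by (rule finite_subset[of _ "{..<n} \<times> {..<n}"], auto)+
  \<comment> \<open>Inserting the smaller index \<open>i\<close> moves the larger \<open>l\<close>
    up by one position, while inserting \<open>l\<close> does not affect \<open>i\<close>; so the
    two orders of removal have opposite signs.\<close>
  have swap: "?g (l, i) = - ?g (i, l)" if il: "i < l" "i \<notin> J" "l \<notin> J" for i l
  proof -
    have "{j \<in> insert i J. j < l} = insert i {j \<in> J. j < l}" using il by auto
    then have "card {j \<in> insert i J. j < l} = Suc (card {j \<in> J. j < l})" using il by simp
    moreover have "{j \<in> insert l J. j < i} = {j \<in> J. j < i}" using il by auto
    moreover have "insert l (insert i J) = insert i (insert l J)" by auto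
    ultimately show ?thesis by (simp add: mult_ac)
  qed
  have B: "?B = prod.swap ` ?A" by (auto simp: image_iff)
  have "koszul n (koszul n f) J = sum ?g (SIGMA i:{..<n} - J. {..<n} - insert i J)"
    by (simp add: koszul_def sum_distrib_left sum.Sigma)
  also have "(SIGMA i:{..<n} - J. {..<n} - insert i J) = ?A \<union> ?B" by auto
  also have "sum ?g (?A \<union> ?B) = sum ?g ?A + sum ?g ?B"
    by (rule sum.union_disjoint[OF fin]) auto
  also have "sum ?g ?B = sum (?g \<circ> prod.swap) ?A"
    unfolding B by (rule sum.reindex) (simp add: inj_on_def)
  also have "\<dots> = (\<Sum>x\<in>?A. - ?g x)"
  proof (rule sum.cong[OF refl])
    fix x assume "x \<in> ?A"
    then obtain i l where "x = (i, l)" "i < l" "i \<notin> J" "l \<notin> J" by auto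
    then show "(?g \<circ> prod.swap) x = - ?g x" using swap[of i l] by simp
  qed
  finally show "koszul n (koszul n f) J = 0 J" by (simp add: sum_negf)
qed

text \<open>\<open>koszul\<close> is given by its coefficient at each target set; this is the usual
  formula by source set. Counting below \<open>i\<close> in \<open>I\<close> or in
  \<open>I - {i}\<close> gives the same sign.\<close>

lemma koszul_ext_basis:
  assumes "I \<subseteq> {..<n}"
  shows "koszul n (ext_basis (I, a)) = (\<Sum>i\<in>I. ext_scale ((- 1) ^ card {j\<in>I. j < i})
           (ext_basis (I - {i}, Poly_Mapping.single i 1 + a)) :: nat set \<Rightarrow> 'a::field mpoly)"
proof
  fix J
  let ?t = "\<lambda>i. if i \<in> I \<and> J = I - {i} then
      (- 1) ^ card {j\<in>J. j < i} * (Poly_Mapping.single (Poly_Mapping.single i 1 + a) 1 :: 'a mpoly) else 0"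
  have "koszul n (ext_basis (I, a)) J = (\<Sum>i\<in>{..<n} - J. ?t i)"
    unfolding koszul_def
  proof (rule sum.cong[OF refl])
    fix i assume "i \<in> {..<n} - J"
    then have "insert i J = I \<longleftrightarrow> i \<in> I \<and> J = I - {i}" by auto
    then show "(- 1) ^ card {j \<in> J. j < i} * Var i * ext_basis (I, a) (insert i J) = ?t i"
      by (simp add: ext_basis_def Var_def mult_single mult.assoc)
  qed
  also have "\<dots> = (\<Sum>i\<in>{..<n}. ?t i)"
    by (rule sum.mono_neutral_left) auto
  also have "\<dots> = (\<Sum>i\<in>I. ?t i)"
    using assms by (intro sum.mono_neutral_right) auto
  also have "\<dots> = (\<Sum>i\<in>I. cscale ((- 1) ^ card {j\<in>I. j < i})
           (ext_basis (I - {i}, Poly_Mapping.single i 1 + a) J))"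
  proof (rule sum.cong[OF refl])
    fix i assume "i \<in> I"
    have "{j \<in> I - {i}. j < i} = {j \<in> I. j < i}" by auto
    moreover have "(- 1 :: 'a mpoly) ^ m * p = cscale ((- 1) ^ m) p" for m p
      by (cases "even m") (simp_all add: cscale_def single_uminus)
    ultimately show "?t i = cscale ((- 1) ^ card {j\<in>I. j < i})
           (ext_basis (I - {i}, Poly_Mapping.single i 1 + a) J)"
      using \<open>i \<in> I\<close> by (simp add: ext_basis_def)
  qed
  finally show "koszul n (ext_basis (I, a)) J = (\<Sum>i\<in>I. ext_scale ((- 1) ^ card {j\<in>I. j < i})
           (ext_basis (I - {i}, Poly_Mapping.single i 1 + a)) :: nat set \<Rightarrow> 'a mpoly) J"
    unfolding sum_fun_apply .
qed

section \<open>A basis of the syzygy module in each degree\<close>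

definition syz_index :: "nat \<Rightarrow> nat \<Rightarrow> nat \<Rightarrow> (nat set \<times> (nat \<Rightarrow>\<^sub>0 nat)) set" where
  "syz_index n k j = {(I, a) \<in> ext_index n k j. \<forall>x\<in>Poly_Mapping.keys a. Min I \<le> x}"

text \<open>If the smallest variable \<open>X\<^sub>x\<close> of a monomial precedes the index set \<open>I\<close>, then applying
  \<open>\<partial>\<partial> = 0\<close> to the wedge with \<open>e\<^sub>x\<close> rewrites the image of \<open>e\<^sub>I\<close> in terms of indices from
  \<open>syz_index\<close>.\<close>
lemma koszul_ext_basis_in_span_syz:
  fixes n k j :: nat
  assumes k: "0 < k" and x: "x \<in> ext_index n k j"
  shows "koszul n (ext_basis x) \<in>
    ext.span (koszul n ` ext_basis ` syz_index n k j :: (nat set \<Rightarrow> 'a::field mpoly) set)"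
    (is "_ \<in> ?S")
proof (cases "x \<in> syz_index n k j")
  case True
  then show ?thesis by (intro ext.span_base) auto
next
  case False
  obtain I a where xI: "x = (I, a)" by (cases x)
  interpret kz: module_hom ext_scale ext_scale "koszul n :: (nat set \<Rightarrow> 'a mpoly) \<Rightarrow> _"
    by (rule module_hom_koszul)
  have I: "I \<subseteq> {..<n}" "card I = k" and a: "Poly_Mapping.keys a \<subseteq> {..<n}" "mon_deg a = j"
    using x xI by (auto simp: ext_index_def Mons_def)
  have finI: "finite I" using I finite_subset by blast
  define u where "u = Min (Poly_Mapping.keys a)"
  obtain y where y: "y \<in> Poly_Mapping.keys a" "y < Min I"
    using False x xI by (auto simp: syz_index_def not_le)
  have u: "u \<in> Poly_Mapping.keys a" "\<And>z. z \<in> Poly_Mapping.keys a \<Longrightarrow> u \<le> z" "u < Min I"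
  proof -
    show "u \<in> Poly_Mapping.keys a" unfolding u_def using y(1) by (intro Min_in) auto
    show le: "\<And>z. z \<in> Poly_Mapping.keys a \<Longrightarrow> u \<le> z" unfolding u_def by simp
    show "u < Min I" using le[OF y(1)] y(2) by simp
  qed
  have uI: "\<And>i. i \<in> I \<Longrightarrow> u < i" using u(3) finI Min_le less_le_trans by blast
  define b where "b = a - Poly_Mapping.single u 1"
  have ab: "a = Poly_Mapping.single u 1 + b" using single_add_diff[OF u(1)] b_def by simp
  have b: "Poly_Mapping.keys b \<subseteq> {..<n}" "Suc (mon_deg b) = j" "\<And>z. z \<in> Poly_Mapping.keys b \<Longrightarrow> u \<le> z"
    using a u(2) by (auto simp: ab keys_add_nat mon_deg_add)
  have un: "u < n" using a(1) u(1) by auto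
  let ?sg = "\<lambda>i. (- 1 :: 'a) ^ card {j \<in> insert u I. j < i}"
  let ?e = "\<lambda>i. ext_basis (insert u I - {i}, Poly_Mapping.single i 1 + b) :: nat set \<Rightarrow> 'a mpoly"
  have "koszul n (ext_basis (insert u I, b)) = (\<Sum>i\<in>insert u I. ext_scale (?sg i) (?e i))"
    using I un by (intro koszul_ext_basis) auto
  also have "\<dots> = ext_scale (?sg u) (?e u) + (\<Sum>i\<in>I. ext_scale (?sg i) (?e i))"
    using finI uI by (subst sum.insert) auto
  \<comment> \<open>As \<open>u\<close> precedes all of \<open>I\<close>, removing it has sign +1
    and returns exactly the element to be rewritten.\<close>
  also have "ext_scale (?sg u) (?e u) = ext_basis x"
  proof -
    have s: "{j \<in> insert u I. j < u} = {}" using uI by force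
    have e: "insert u I - {u} = I" using uI by force
    show ?thesis unfolding s e ab[symmetric] xI by simp
  qed
  finally have eq: "koszul n (ext_basis (insert u I, b)) = ext_basis x + (\<Sum>i\<in>I. ext_scale (?sg i) (?e i))" .
  have "koszul n (ext_basis x + (\<Sum>i\<in>I. ext_scale (?sg i) (?e i))) = 0"
    unfolding eq[symmetric] by (rule koszul_koszul)
  then have "koszul n (ext_basis x) = - (\<Sum>i\<in>I. ext_scale (?sg i) (koszul n (?e i)))"
    unfolding kz.add kz.sum kz.scale by (rule eq_neg_iff_add_eq_0[THEN iffD2])
  \<comment> \<open>All other terms keep \<open>u\<close> in their index set, as its minimum, and
    \<open>u\<close> was the smallest variable of the monomial.\<close>
  moreover have span: "koszul n (?e i) \<in> ?S" if i: "i \<in> I" for i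
  proof -
    have eq: "insert u I - {i} = insert u (I - {i})" using uI i by force
    have "card (insert u I - {i}) = k"
      using I(2) finI i uI k unfolding eq by (subst card_insert_disjoint) auto
    moreover have "Min (insert u I - {i}) = u"
      unfolding eq using finI uI by (intro Min_eqI) (auto intro: less_imp_le)
    moreover have "u \<le> z" if "z \<in> Poly_Mapping.keys (Poly_Mapping.single i 1 + b)" for z
      using that b(3) uI[OF i] by (auto simp: keys_add_nat)
    ultimately have "(insert u I - {i}, Poly_Mapping.single i 1 + b) \<in> syz_index n k j"
      using I un b i by (auto simp: syz_index_def ext_index_def Mons_def keys_add_nat mon_deg_add)
    then show ?thesis by (intro ext.span_base) blast
  qed
  moreover have "- (\<Sum>i\<in>I. ext_scale (?sg i) (koszul n (?e i))) \<in> ?S"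
    by (intro ext.span_neg ext.span_sum ext.span_scale span)
  ultimately show ?thesis by (simp only:)
qed

text \<open>The functional dual to the image of \<open>X\<^sup>a e\<^sub>I\<close>, where \<open>i = Min I\<close>, reads off the
  coefficient of \<open>X\<^sub>i X\<^sup>a e\<^sub>J\<close> with \<open>J = I - {i}\<close>.\<close>
lemma koszul_dual:
  assumes k: "0 < k" and x: "(I, a) \<in> syz_index n k j" and y: "(I', a') \<in> syz_index n k j"
  shows "Poly_Mapping.lookup (koszul n (ext_basis (I', a')) (I - {Min I})) (Poly_Mapping.single (Min I) 1 + a)
    = (if (I, a) = (I', a') then 1 else (0 :: 'a::field))"
proof -
  let ?i = "Min I" and ?i' = "Min I'"
  have I: "I \<subseteq> {..<n}" "card I = k" "\<And>z. z \<in> Poly_Mapping.keys a \<Longrightarrow> ?i \<le> z"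
    using x by (auto simp: syz_index_def ext_index_def)
  have I': "I' \<subseteq> {..<n}" "card I' = k" "\<And>z. z \<in> Poly_Mapping.keys a' \<Longrightarrow> ?i' \<le> z"
    using y by (auto simp: syz_index_def ext_index_def)
  have fin: "finite I" "finite I'" using I(1) I'(1) finite_subset by blast+
  have ne: "I \<noteq> {}" "I' \<noteq> {}" using I(2) I'(2) k by auto
  have min: "?i \<in> I" "?i' \<in> I'" "\<And>z. z \<in> I \<Longrightarrow> ?i \<le> z" "\<And>z. z \<in> I' \<Longrightarrow> ?i' \<le> z"
    using fin ne by auto
  \<comment> \<open>Comparing supports gives \<open>Min I' \<le> Min I\<close>. If \<open>i\<close>
    were not \<open>Min I'\<close>, then \<open>Min I'\<close> would survive in
    \<open>I - {Min I}\<close> and exceed \<open>Min I\<close>.\<close>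
  have key: "(I - {?i} = I' - {i} \<and> Poly_Mapping.single ?i 1 + a = Poly_Mapping.single i 1 + a')
      \<longleftrightarrow> (i = ?i' \<and> (I, a) = (I', a'))" if i: "i \<in> I'" for i
  proof
    assume eq: "I - {?i} = I' - {i} \<and> Poly_Mapping.single ?i 1 + a = Poly_Mapping.single i 1 + a'"
    have "Poly_Mapping.keys (Poly_Mapping.single ?i 1 + a) = Poly_Mapping.keys (Poly_Mapping.single i 1 + a')"
      using eq by simp
    then have keys: "insert ?i (Poly_Mapping.keys a) = insert i (Poly_Mapping.keys a')"
      by (simp add: keys_add_nat)
    have "?i \<in> insert i (Poly_Mapping.keys a')" "i \<in> insert ?i (Poly_Mapping.keys a)"
      using keys by blast+
    then have "?i' \<le> ?i" "?i \<le> i" using I(3) I'(3) min(4)[OF i] by auto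
    have ii: "i = ?i'"
    proof (rule ccontr)
      assume "i \<noteq> ?i'"
      then have "?i' \<in> I - {?i}" using eq min(2) by blast
      then have "?i < ?i'" using min(3) by force
      then show False using \<open>?i' \<le> ?i\<close> by simp
    qed
    then have "?i = i" using \<open>?i' \<le> ?i\<close> \<open>?i \<le> i\<close> by simp
    then show "i = ?i' \<and> (I, a) = (I', a')"
      using eq ii min(1) i by (metis add_left_cancel insert_Diff)
  qed auto
  have "Poly_Mapping.lookup (koszul n (ext_basis (I', a')) (I - {?i})) (Poly_Mapping.single ?i 1 + a)
    = (\<Sum>i\<in>I'. (- 1 :: 'a) ^ card {j\<in>I'. j < i} *
        (if I - {?i} = I' - {i} \<and> Poly_Mapping.single ?i 1 + a = Poly_Mapping.single i 1 + a' then 1 else 0))"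
    unfolding koszul_ext_basis[OF I'(1)] sum_fun_apply lookup_sum
    by (intro sum.cong) (auto simp: ext_basis_def lookup_single when_def)
  also have "\<dots> = (\<Sum>i\<in>I'. if i = ?i' then (if (I, a) = (I', a') then (- 1) ^ card {j\<in>I'. j < i} else 0) else 0)"
  proof (rule sum.cong[OF refl])
    fix i assume i: "i \<in> I'"
    show "(- 1 :: 'a) ^ card {j\<in>I'. j < i} *
        (if I - {?i} = I' - {i} \<and> Poly_Mapping.single ?i 1 + a = Poly_Mapping.single i 1 + a' then 1 else 0)
      = (if i = ?i' then (if (I, a) = (I', a') then (- 1) ^ card {j\<in>I'. j < i} else 0) else 0)"
      unfolding key[OF i] by (simp only: if_True if_False mult_1_right mult_zero_right split: if_split) blast
  qed
  also have "\<dots> = (if (I, a) = (I', a') then (- 1) ^ card {j\<in>I'. j < ?i'} else 0)"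
    by (simp add: sum.delta[OF fin(2)] min(2))
  also have "{j\<in>I'. j < ?i'} = {}" using min(4) by force
  finally show ?thesis by simp
qed

text \<open>Sort by \<open>i = Min I\<close>: the other \<open>k - 1\<close> elements of
  \<open>I\<close> are chosen among the \<open>n - 1 - i\<close> larger indices, and the monomial
  uses the \<open>n - i\<close> variables from \<open>i\<close> on.\<close>

lemma card_syz_index:
  assumes k: "0 < k"
  shows "card (syz_index n k j) = (\<Sum>i<n. ((n - 1 - i) choose (k - 1)) * ((n - i + j - 1) choose j))"
proof -
  define T where "T i = insert i ` {S. S \<subseteq> {Suc i..<n} \<and> card S = k - 1}" for i
  have Min_T: "Min I = i" if "I \<in> T i" for I i
  proof -
    obtain S where "I = insert i S" "S \<subseteq> {Suc i..<n}" using \<open>I \<in> T i\<close> by (auto simp: T_def)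
    moreover then have "finite S" using finite_subset by blast
    ultimately show ?thesis by (intro Min_eqI) force+
  qed
  have finS: "finite {S. S \<subseteq> {Suc i..<n} \<and> card S = k - 1}" for i
    by (rule finite_subset[of _ "Pow {Suc i..<n}"]) auto
  have cardT: "card (T i) = (n - 1 - i) choose (k - 1)" for i
  proof -
    have "inj_on (insert i) {S. S \<subseteq> {Suc i..<n} \<and> card S = k - 1}"
    proof (rule inj_onI)
      fix S S' assume "S \<in> {S. S \<subseteq> {Suc i..<n} \<and> card S = k - 1}" "S' \<in> {S. S \<subseteq> {Suc i..<n} \<and> card S = k - 1}"
        and "insert i S = insert i S'"
      moreover from this have "i \<notin> S" "i \<notin> S'" by auto
      ultimately show "S = S'" by (metis insert_ident)
    qed
    then have "card (T i) = card {S. S \<subseteq> {Suc i..<n} \<and> card S = k - 1}"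
      by (simp add: T_def card_image)
    also have "\<dots> = (n - Suc i) choose (k - 1)"
      using n_subsets[of "{Suc i..<n}" "k - 1"] by simp
    finally show ?thesis by simp
  qed
  have "syz_index n k j = (\<Union>i<n. T i \<times> Mons {i..<n} j)"
  proof (intro set_eqI iffI)
    fix x assume "x \<in> syz_index n k j"
    then obtain I a where x: "x = (I, a)" "I \<subseteq> {..<n}" "card I = k" "Poly_Mapping.keys a \<subseteq> {..<n}"
      "mon_deg a = j" "\<And>z. z \<in> Poly_Mapping.keys a \<Longrightarrow> Min I \<le> z"
      by (auto simp: syz_index_def ext_index_def Mons_def)
    have fin: "finite I" using x finite_subset by blast
    have "I \<noteq> {}" using x(3) k by auto
    then have Min: "Min I \<in> I" using fin by simp
    have "I = insert (Min I) (I - {Min I})" using Min by auto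
    moreover have "I - {Min I} \<subseteq> {Suc (Min I)..<n}"
    proof
      fix z assume z: "z \<in> I - {Min I}"
      then have "Min I \<le> z" "z \<noteq> Min I" "z < n" using fin x(2) by auto
      then show "z \<in> {Suc (Min I)..<n}" by auto
    qed
    moreover have "card (I - {Min I}) = k - 1" using Min x(3) fin by simp
    ultimately have "I \<in> T (Min I)" unfolding T_def by blast
    moreover have "a \<in> Mons {Min I..<n} j" using x by (auto simp: Mons_def)
    ultimately show "x \<in> (\<Union>i<n. T i \<times> Mons {i..<n} j)" using x(1,2) Min by blast
  next
    fix x assume "x \<in> (\<Union>i<n. T i \<times> Mons {i..<n} j)"
    then obtain i I a where x: "i < n" "x = (I, a)" "I \<in> T i" "a \<in> Mons {i..<n} j" by auto
    then obtain S where S: "I = insert i S" "S \<subseteq> {Suc i..<n}" "card S = k - 1" by (auto simp: T_def)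
    have "finite S" using S(2) finite_subset by blast
    moreover have "i \<notin> S" using S(2) by auto
    ultimately have "card I = k" using S k by simp
    then show "x \<in> syz_index n k j"
      using x S Min_T[OF x(3)] by (auto simp: syz_index_def ext_index_def Mons_def)
  qed
  also have "card \<dots> = (\<Sum>i<n. card (T i \<times> Mons {i..<n} j))"
  proof (rule card_UN_disjoint)
    show "\<forall>i\<in>{..<n}. finite (T i \<times> Mons {i..<n} j)"
      using finS by (auto simp: T_def finite_Mons)
    show "\<forall>i\<in>{..<n}. \<forall>i'\<in>{..<n}. i \<noteq> i' \<longrightarrow> T i \<times> Mons {i..<n} j \<inter> T i' \<times> Mons {i'..<n} j = {}"
      using Min_T by blast
  qed simp
  finally show ?thesis by (simp add: card_cartesian_product cardT card_Mons)
qed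

lemma vdim_Mcomp:
  assumes k: "0 < k"
  shows "vdim_ext (Mcomp n k (int (k + j)) :: (nat set \<Rightarrow> 'a::field mpoly) set)
    = (\<Sum>i<n. ((n - 1 - i) choose (k - 1)) * ((n - i + j - 1) choose j))"
proof -
  interpret kz: module_hom ext_scale ext_scale "koszul n :: (nat set \<Rightarrow> 'a mpoly) \<Rightarrow> _"
    by (rule module_hom_koszul)
  let ?v = "\<lambda>x. koszul n (ext_basis x) :: nat set \<Rightarrow> 'a mpoly"
  have "(Mcomp n k (int (k + j)) :: (nat set \<Rightarrow> 'a mpoly) set) = ext.span (koszul n ` ext_basis ` ext_index n k j)"
    unfolding Mcomp_def ExtComp_eq_span kz.span_image ..
  also have "\<dots> = ext.span (koszul n ` ext_basis ` syz_index n k j)"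
    unfolding ext.span_eq
  proof
    show "koszul n ` ext_basis ` ext_index n k j
        \<subseteq> ext.span (koszul n ` ext_basis ` syz_index n k j :: (nat set \<Rightarrow> 'a mpoly) set)"
      using koszul_ext_basis_in_span_syz[OF k] by blast
    show "koszul n ` ext_basis ` syz_index n k j
        \<subseteq> ext.span (koszul n ` ext_basis ` ext_index n k j :: (nat set \<Rightarrow> 'a mpoly) set)"
      using ext.span_superset by (auto simp: syz_index_def intro!: ext.span_base)
  qed
  also have "koszul n ` ext_basis ` syz_index n k j = ?v ` syz_index n k j" by (simp add: image_image)
  finally have "vdim_ext (Mcomp n k (int (k + j)) :: (nat set \<Rightarrow> 'a mpoly) set)
      = ext.dim (ext.span (?v ` syz_index n k j))" by (simp add: vdim_ext_def)
  also have "\<dots> = card (syz_index n k j)"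
  proof (rule ext.dim_span_biorthogonal[where \<phi> = "\<lambda>(I, a) g. Poly_Mapping.lookup (g (I - {Min I})) (Poly_Mapping.single (Min I) 1 + a)"])
    show "finite (syz_index n k j)"
      by (rule finite_subset[OF _ finite_ext_index[of n k j]]) (auto simp: syz_index_def)
  next
    fix x y assume "x \<in> syz_index n k j" "y \<in> syz_index n k j"
    then show "(\<lambda>(I, a) g. Poly_Mapping.lookup (g (I - {Min I})) (Poly_Mapping.single (Min I) 1 + a)) x (?v y)
        = (if x = y then 1 else 0)"
      by (cases x; cases y) (simp add: koszul_dual[OF k] del: One_nat_def)
  qed (auto simp: lookup_add)
  also note card_syz_index[OF k]
  finally show ?thesis .
qed

lemma koszul_0: "koszul n 0 = 0"
  by (simp add: koszul_def fun_eq_iff)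

lemma vdim_Mcomp_low:
  assumes "d < int k"
  shows "vdim_ext (Mcomp n k d :: (nat set \<Rightarrow> 'a::field mpoly) set) = 0"
proof -
  have "(Rcomp n (d - int k) :: 'a mpoly set) = {0}"
    using assms ex_key_if_nonzero by (fastforce simp: Rcomp_def)
  then have "(ExtComp n k d :: (nat set \<Rightarrow> 'a mpoly) set) \<subseteq> {0}" by (auto simp: ExtComp_def)
  then have "(Mcomp n k d :: (nat set \<Rightarrow> 'a mpoly) set) \<subseteq> ext.span {}"
    using koszul_0 by (auto simp: Mcomp_def dest!: subsetD)
  then show ?thesis using ext.dim_le_card[of "Mcomp n k d" "{}"] by (simp add: vdim_ext_def)
qed

section \<open>Hilbert series and Hilbert depth\<close>

unbundle fps_syntax

text \<open>The Hilbert series \<open>1/(1-T)^p\<close> of a polynomial ring in \<open>p\<close>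
  variables, equal to 1 for \<open>p = 0\<close> by truncated subtraction. Coefficients stay
  integral, so division by powers of \<open>1 - T\<close> is expressed as multiplication by this
  series.\<close>

definition poly_series :: "nat \<Rightarrow> int fps" where
  "poly_series p = Abs_fps (\<lambda>j. int ((p + j - 1) choose j))"

lemma poly_series_nth: "poly_series p $ j = int ((p + j - 1) choose j)"
  by (simp add: poly_series_def)

lemma poly_series_0: "poly_series 0 = 1"
proof (rule fps_ext)
  fix j show "poly_series 0 $ j = 1 $ j" by (cases j) (simp_all add: poly_series_nth)
qed

lemma one_minus_X_mult_nth: "((1 - fps_X) * F) $ j = F $ j - (if j = 0 then 0 else F $ (j - 1))"
  for F :: "int fps"
  by (simp add: left_diff_distrib)

lemma poly_series_Suc: "(1 - fps_X) * poly_series (Suc p) = poly_series p"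
proof (rule fps_ext)
  fix j show "((1 - fps_X) * poly_series (Suc p)) $ j = poly_series p $ j"
    by (cases j) (simp_all only: one_minus_X_mult_nth, simp_all add: poly_series_nth)
qed

lemma one_minus_X_power_poly_series: "(1 - fps_X) ^ r * poly_series (r + p) = poly_series p"
proof (induction r)
  case (Suc r)
  have "(1 - fps_X) ^ Suc r * poly_series (Suc r + p)
      = (1 - fps_X) ^ r * ((1 - fps_X) * poly_series (Suc (r + p)))"
    by (simp add: mult_ac)
  then show ?case by (simp add: poly_series_Suc Suc)
qed simp

lemma one_minus_X_power_poly_series_self: "(1 - fps_X) ^ r * poly_series r = 1"
  using one_minus_X_power_poly_series[of r 0] by (simp add: poly_series_0)

lemma poly_series_cancel:
  "poly_series r * ((1 - fps_X) ^ r * F) = F" "(1 - fps_X) ^ r * (poly_series r * F) = F"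
proof -
  have "poly_series r * ((1 - fps_X) ^ r * F) = ((1 - fps_X) ^ r * poly_series r) * F"
    by (simp only: mult_ac)
  then show "poly_series r * ((1 - fps_X) ^ r * F) = F"
    by (simp only: one_minus_X_power_poly_series_self mult_1)
  have "(1 - fps_X) ^ r * (poly_series r * F) = ((1 - fps_X) ^ r * poly_series r) * F"
    by (simp only: mult_ac)
  then show "(1 - fps_X) ^ r * (poly_series r * F) = F"
    by (simp only: one_minus_X_power_poly_series_self mult_1)
qed

lemma poly_series_mult: "poly_series r * poly_series p = poly_series (r + p)"
proof -
  have "poly_series r * ((1 - fps_X) ^ r * poly_series (r + p)) = poly_series (r + p)"
    by (rule poly_series_cancel)
  then show ?thesis by (simp only: one_minus_X_power_poly_series)
qed

lemma one_minus_X_power_nth: "((1 - fps_X) ^ m :: int fps) $ j = (- 1) ^ j * int (m choose j)"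
proof (induction m arbitrary: j)
  case 0
  then show ?case by (cases j) auto
next
  case (Suc m)
  show ?case
    unfolding power_Suc one_minus_X_mult_nth Suc by (cases j) (simp_all add: algebra_simps)
qed

section \<open>Nonnegative combinations of shifted Hilbert series of polynomial rings\<close>

definition list_series :: "(nat \<times> nat) list \<Rightarrow> int fps" where
  "list_series D = (\<Sum>(p, s)\<leftarrow>D. fps_X ^ s * poly_series p)"

text \<open>A retract enters a Hilbert decomposition only through its dimension \<open>p\<close> and
  its shift \<open>s\<close>, so pairs of numbers suffice. The bound \<open>n\<close> is the largest
  dimension of a retract; the empty list is allowed and gives the series 0.\<close>

definition decomposable :: "nat \<Rightarrow> nat \<Rightarrow> int fps \<Rightarrow> bool" where
  "decomposable r n F \<longleftrightarrow> (\<exists>D. (\<forall>(p, s)\<in>set D. r \<le> p \<and> p \<le> n) \<and> list_series D = F)"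

lemma decomposable_0: "decomposable r n 0"
  unfolding decomposable_def by (rule exI[of _ "[]"]) (simp add: list_series_def)

lemma decomposable_add:
  assumes "decomposable r n F" "decomposable r n G"
  shows "decomposable r n (F + G)"
proof -
  obtain D D' where "\<forall>(p, s)\<in>set D. r \<le> p \<and> p \<le> n" "list_series D = F"
    "\<forall>(p, s)\<in>set D'. r \<le> p \<and> p \<le> n" "list_series D' = G"
    using assms unfolding decomposable_def by blast
  then show ?thesis
    unfolding decomposable_def by (intro exI[of _ "D @ D'"]) (auto simp: list_series_def)
qed

lemma decomposable_sum:
  assumes "\<And>i. i \<in> A \<Longrightarrow> decomposable r n (F i)"
  shows "decomposable r n (\<Sum>i\<in>A. F i)"
  using assms
  by (induction A rule: infinite_finite_induct) (simp_all add: decomposable_0 decomposable_add)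

lemma decomposable_base:
  assumes "r \<le> p" "p \<le> n"
  shows "decomposable r n (fps_X ^ s * poly_series p)"
  unfolding decomposable_def
  by (rule exI[of _ "[(p, s)]"]) (use assms in \<open>simp add: list_series_def\<close>)

lemma decomposable_of_nat_mult:
  assumes "decomposable r n F"
  shows "decomposable r n (of_nat c * F)"
  using assms by (induction c) (simp_all add: decomposable_0 decomposable_add distrib_right)

text \<open>Each summand receives \<open>q\<close> more variables. This restores the variables that
  multiplication by a power of \<open>1 - T\<close> has removed.\<close>

lemma decomposable_shift:
  assumes "decomposable r n F"
  shows "decomposable (q + r) (q + n) (fps_X ^ N * poly_series q * F)"
proof -
  obtain D where D: "\<forall>(p, s)\<in>set D. r \<le> p \<and> p \<le> n" "list_series D = F"
    using assms unfolding decomposable_def by blast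
  have "list_series (map (\<lambda>(p, s). (q + p, N + s)) D) = fps_X ^ N * poly_series q * list_series D"
    by (induction D)
      (auto simp: list_series_def distrib_left power_add mult_ac simp flip: poly_series_mult)
  then show ?thesis
    unfolding decomposable_def using D
    by (intro exI[of _ "map (\<lambda>(p, s). (q + p, N + s)) D"]) auto
qed

text \<open>Every summand has at least \<open>r\<close> variables, so \<open>(1-T)^r\<close> cancels
  against it and leaves the Hilbert series of a smaller polynomial ring.\<close>

lemma decomposable_nonneg:
  assumes "decomposable r n F"
  shows "0 \<le> ((1 - fps_X) ^ r * F) $ d"
proof -
  obtain D where D: "\<forall>(p, s)\<in>set D. r \<le> p \<and> p \<le> n" and F: "F = list_series D"
    using assms unfolding decomposable_def by blast
  show ?thesis unfolding F using D
  proof (induction D)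
    case (Cons x D)
    obtain p s where x: "x = (p, s)" by (cases x)
    obtain q where q: "p = r + q" using Cons.prems x le_Suc_ex by auto
    have "(1 - fps_X) ^ r * list_series (x # D)
        = fps_X ^ s * ((1 - fps_X) ^ r * poly_series (r + q)) + (1 - fps_X) ^ r * list_series D"
      by (simp add: list_series_def x q distrib_left mult_ac)
    then show ?case
      using Cons by (simp add: one_minus_X_power_poly_series fps_X_power_mult_nth poly_series_nth)
  qed (simp add: list_series_def)
qed

text \<open>Induction on \<open>s\<close>: the tail of \<open>Q\<close> is the tail of
  \<open>(1-T) Q\<close> with one more variable in each summand, plus copies of
  \<open>1/(1-T)\<close>. At \<open>s = 0\<close> the tail vanishes.\<close>

lemma eventually_decomposable_fps_shift:
  fixes Q :: "int fps"
  assumes "\<And>i. i < s \<Longrightarrow> eventually (\<lambda>N. 0 \<le> ((1 - fps_X) ^ i * Q) $ N) sequentially"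
    and "eventually (\<lambda>N. ((1 - fps_X) ^ s * Q) $ N = 0) sequentially"
  shows "eventually (\<lambda>N. decomposable 0 s (fps_shift N Q)) sequentially"
  using assms
proof (induction s arbitrary: Q)
  case 0
  then obtain N0 where N0: "\<And>N. N \<ge> N0 \<Longrightarrow> Q $ N = 0" by (auto simp: eventually_sequentially)
  then have "fps_shift N Q = 0" if "N \<ge> N0" for N
    using that by (intro fps_ext) simp
  then show ?case
    unfolding eventually_sequentially by (intro exI[of _ N0]) (auto simp: decomposable_0)
next
  case (Suc s)
  let ?Q = "(1 - fps_X) * Q"
  have "eventually (\<lambda>N. decomposable 0 s (fps_shift N ?Q)) sequentially"
  proof (rule Suc.IH)
    fix i assume "i < s"
    then show "eventually (\<lambda>N. 0 \<le> ((1 - fps_X) ^ i * ?Q) $ N) sequentially"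
      using Suc.prems(1)[of "Suc i"] by (simp only: power_Suc2 mult.assoc)
  next
    show "eventually (\<lambda>N. ((1 - fps_X) ^ s * ?Q) $ N = 0) sequentially"
      using Suc.prems(2) by (simp only: power_Suc2 mult.assoc)
  qed
  then have "eventually (\<lambda>N. decomposable 0 s (fps_shift (Suc N) ?Q)) sequentially"
    by (simp add: eventually_sequentially_Suc[of "\<lambda>N. decomposable 0 s (fps_shift N ?Q)"])
  moreover have "eventually (\<lambda>N. 0 \<le> Q $ N) sequentially" using Suc.prems(1)[of 0] by simp
  ultimately have "eventually (\<lambda>N. decomposable 0 (Suc s) (fps_shift (Suc N) Q)) sequentially"
  proof eventually_elim
    case (elim N)
    \<comment> \<open>Taking differences before or after cutting differs only at coefficient 0,
      where the cut series no longer sees its predecessor \<open>Q $ N\<close>.\<close>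
    have "(1 - fps_X) * fps_shift (Suc N) Q = fps_shift (Suc N) ?Q + fps_const (Q $ N)"
    proof (rule fps_ext)
      fix j show "((1 - fps_X) * fps_shift (Suc N) Q) $ j = (fps_shift (Suc N) ?Q + fps_const (Q $ N)) $ j"
        by (cases j) (simp_all only: one_minus_X_mult_nth fps_shift_nth fps_add_nth, simp_all)
    qed
    moreover have "fps_const (Q $ N) = of_nat (nat (Q $ N))"
      using fps_of_nat[of "nat (Q $ N)", where ?'a = int] elim(2) by simp
    ultimately have "poly_series 1 * ((1 - fps_X) * fps_shift (Suc N) Q)
        = fps_X ^ 0 * poly_series 1 * fps_shift (Suc N) ?Q + of_nat (nat (Q $ N)) * (fps_X ^ 0 * poly_series 1)"
      by (simp add: distrib_left mult.commute)
    moreover have "poly_series 1 * ((1 - fps_X) * fps_shift (Suc N) Q) = fps_shift (Suc N) Q"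
      using poly_series_cancel(1)[of 1] by simp
    moreover have "decomposable 0 (Suc s) (fps_X ^ 0 * poly_series 1 * fps_shift (Suc N) ?Q)"
    proof -
      have "decomposable (1 + 0) (1 + s) (fps_X ^ 0 * poly_series 1 * fps_shift (Suc N) ?Q)"
        by (rule decomposable_shift[OF elim(1)])
      then show ?thesis unfolding decomposable_def by fastforce
    qed
    moreover have "decomposable 0 (Suc s) (of_nat (nat (Q $ N)) * (fps_X ^ 0 * poly_series 1))"
      by (intro decomposable_of_nat_mult decomposable_base) auto
    ultimately show ?case by (metis decomposable_add)
  qed
  then show ?case
    by (simp add: eventually_sequentially_Suc[of "\<lambda>N. decomposable 0 (Suc s) (fps_shift N Q)"])
qed

text \<open>Integer differences bounded below by 1 give linear growth, which overcomes any negative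
  start. Mere nonnegativity of the differences would not pass on, hence the bound 1.\<close>

lemma eventually_ge_1_of_difference:
  fixes F :: "int fps"
  assumes "eventually (\<lambda>N. 1 \<le> ((1 - fps_X) * F) $ N) sequentially"
  shows "eventually (\<lambda>N. 1 \<le> F $ N) sequentially"
proof -
  obtain N0 where N0: "\<And>N. N \<ge> N0 \<Longrightarrow> 1 \<le> ((1 - fps_X) * F) $ N"
    using assms by (auto simp: eventually_sequentially)
  have ge: "F $ (N0 + t) \<ge> F $ N0 + int t" for t
  proof (induction t)
    case (Suc t)
    then show ?case using N0[of "N0 + Suc t"] unfolding one_minus_X_mult_nth by simp
  qed simp
  have "1 \<le> F $ N" if "N \<ge> N0 + nat (1 - F $ N0)" for N
    using that ge[of "N - N0"] by simp
  then show ?thesis unfolding eventually_sequentially by blast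
qed

section \<open>The Hilbert series of the syzygy module and its coefficients\<close>

definition syz_series :: "nat \<Rightarrow> nat \<Rightarrow> int fps" where
  "syz_series n k = (\<Sum>i<n. of_nat ((n - 1 - i) choose (k - 1)) * (fps_X ^ k * poly_series (n - i)))"

definition syz_numerator :: "nat \<Rightarrow> nat \<Rightarrow> int fps" where
  "syz_numerator n k = (\<Sum>i<n. of_nat ((n - 1 - i) choose (k - 1)) * (fps_X ^ k * (1 - fps_X) ^ i))"

lemma syz_series_nth:
  "syz_series n k $ d = (if d < k then 0
     else int (\<Sum>i<n. ((n - 1 - i) choose (k - 1)) * ((n - i + (d - k) - 1) choose (d - k))))"
proof -
  have "(of_nat c * (fps_X ^ k * G)) $ d = (if d < k then 0 else int c * G $ (d - k))" for c and G :: "int fps"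
    by (simp add: fps_of_nat[symmetric] fps_X_power_mult_nth)
  then show ?thesis by (simp add: syz_series_def fps_sum_nth poly_series_nth)
qed

lemma syz_numerator_eq: "(1 - fps_X) ^ n * syz_series n k = syz_numerator n k"
proof -
  have summand: "(1 - fps_X) ^ n * (of_nat c * (fps_X ^ k * poly_series (n - i)))
      = of_nat c * (fps_X ^ k * (1 - fps_X) ^ i)" if "i < n" for i c
  proof -
    have "(1 - fps_X :: int fps) ^ n = (1 - fps_X) ^ i * (1 - fps_X) ^ (n - i)"
      using that by (simp flip: power_add)
    then have "(1 - fps_X) ^ n * (of_nat c * (fps_X ^ k * poly_series (n - i)))
      = of_nat c * (fps_X ^ k * (1 - fps_X) ^ i) * ((1 - fps_X) ^ (n - i) * poly_series (n - i))"
      by (simp add: mult_ac)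
    then show ?thesis by (simp add: one_minus_X_power_poly_series_self)
  qed
  show ?thesis
    unfolding syz_series_def syz_numerator_def sum_distrib_left
    by (intro sum.cong refl summand) simp
qed

text \<open>Splitting off the summand \<open>i = 0\<close> gives a recursion in \<open>n\<close>
  that is Pascal's rule above degree \<open>k\<close>; in degree \<open>k\<close> itself the new
  summand supplies the binomial coefficient lost by the truncation.\<close>

lemma syz_numerator_nth:
  assumes "0 < k"
  shows "syz_numerator n k $ j = (if j < k then 0 else (- 1) ^ (j - k) * int (n choose j))"
proof (induction n arbitrary: j)
  case 0
  then show ?case using assms by (simp add: syz_numerator_def)
next
  case (Suc n)
  have "syz_numerator (Suc n) k = of_nat (n choose (k - 1)) * fps_X ^ k + (1 - fps_X) * syz_numerator n k"
    unfolding syz_numerator_def sum.lessThan_Suc_shift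
    by (simp add: sum_distrib_left mult_ac)
  then have "syz_numerator (Suc n) k $ j = (if j = k then int (n choose (k - 1)) else 0)
      + (syz_numerator n k $ j - (if j = 0 then 0 else syz_numerator n k $ (j - 1)))"
    by (simp only: fps_add_nth one_minus_X_mult_nth) (simp add: fps_of_nat[symmetric])
  also have "\<dots> = (if j < k then 0 else (- 1) ^ (j - k) * int (Suc n choose j))"
  proof -
    consider "j < k" | "j = k" | "j > k" by linarith
    then show ?thesis
    proof cases
      case 1
      then show ?thesis by (simp add: Suc)
    next
      case 2
      then show ?thesis unfolding Suc using assms by (cases k) simp_all
    next
      case 3
      then obtain i where i: "j = Suc i" "i \<ge> k" by (cases j) auto
      then show ?thesis by (simp add: Suc Suc_diff_le algebra_simps)
    qed
  qed
  finally show ?case .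
qed

text \<open>The coefficient of degree \<open>k + m\<close> of \<open>(1 - T)\<^bsup>n - s\<^esup>\<close> times the Hilbert series.\<close>
definition syz_coeff :: "nat \<Rightarrow> nat \<Rightarrow> nat \<Rightarrow> nat \<Rightarrow> int" where
  "syz_coeff n k s m = (poly_series s * syz_numerator n k) $ (k + m)"

lemma syz_series_mult_eq:
  assumes "n = r + s"
  shows "(1 - fps_X) ^ r * syz_series n k = poly_series s * syz_numerator n k"
proof -
  have "poly_series s * syz_numerator n k
      = ((1 - fps_X) ^ s * poly_series s) * ((1 - fps_X) ^ r * syz_series n k)"
    unfolding syz_numerator_eq[symmetric] assms power_add by (simp add: mult_ac)
  then show ?thesis by (simp add: one_minus_X_power_poly_series_self)
qed

lemma poly_series_syz_numerator_low:
  assumes "0 < k" "d < k"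
  shows "(poly_series s * syz_numerator n k) $ d = 0"
  unfolding fps_mult_nth using assms by (intro sum.neutral) (auto simp: syz_numerator_nth)

lemma syz_coeff_upper:
  assumes "0 < k"
  shows "syz_coeff n k s m
    = (\<Sum>i<Suc m. (- 1) ^ i * int ((n choose (k + i)) * ((s + (m - i) - 1) choose (m - i))))"
proof -
  let ?t = "\<lambda>j. syz_numerator n k $ j * poly_series s $ (k + m - j)"
  have "syz_coeff n k s m = (\<Sum>j=0..k + m. ?t j)"
    unfolding syz_coeff_def by (subst mult.commute) (simp add: fps_mult_nth)
  also have "\<dots> = (\<Sum>j=k..k + m. ?t j)"
    using assms by (intro sum.mono_neutral_right) (auto simp: syz_numerator_nth)
  also have "\<dots> = (\<Sum>i=0..m. ?t (k + i))"
    using sum.shift_bounds_cl_nat_ivl[of ?t 0 k m] by (simp add: add.commute)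
  also have "\<dots> = (\<Sum>i<Suc m. (- 1) ^ i * int ((n choose (k + i)) * ((s + (m - i) - 1) choose (m - i))))"
    using assms by (intro sum.cong) (auto simp: syz_numerator_nth poly_series_nth)
  finally show ?thesis .
qed

text \<open>The numerator is \<open>(-1)^k\<close> times \<open>(1-T)^n\<close> minus its part
  \<open>low\<close> in degrees below \<open>k\<close>. Division by \<open>(1-T)^s\<close> turns the
  full power into \<open>(1-T)^(n-s)\<close>, with explicit coefficients; \<open>low\<close> yields
  the alternating sum.\<close>

lemma syz_coeff_lower:
  assumes "0 < k" "s \<le> n"
  shows "syz_coeff n k s m = (- 1) ^ m * int ((n - s) choose (k + m))
    + (\<Sum>i<k. (- 1) ^ i * int ((n choose (k - 1 - i)) * ((s + m + i) choose (m + 1 + i))))"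
proof -
  define low :: "int fps" where "low = Abs_fps (\<lambda>j. if j < k then (- 1) ^ j * int (n choose j) else 0)"
  have num: "syz_numerator n k = fps_const ((- 1) ^ k) * ((1 - fps_X) ^ n - low)"
  proof (rule fps_ext)
    fix j
    have "(- 1 :: int) ^ (j - k) = (- 1) ^ k * (- 1) ^ j" if "\<not> j < k"
      using that by (simp add: minus_one_power_iff)
    then show "syz_numerator n k $ j = (fps_const ((- 1) ^ k) * ((1 - fps_X) ^ n - low)) $ j"
      using assms(1) by (simp add: syz_numerator_nth low_def one_minus_X_power_nth)
  qed
  have "poly_series s * (1 - fps_X) ^ n = ((1 - fps_X) ^ s * poly_series s) * (1 - fps_X) ^ (n - s)"
    using assms(2) by (simp add: mult_ac flip: power_add)
  then have pn: "poly_series s * (1 - fps_X) ^ n = (1 - fps_X) ^ (n - s)"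
    by (simp add: one_minus_X_power_poly_series_self)
  have "syz_coeff n k s m = (- 1) ^ k * ((poly_series s * (1 - fps_X) ^ n - low * poly_series s) $ (k + m))"
  proof -
    have "poly_series s * syz_numerator n k
        = fps_const ((- 1) ^ k) * (poly_series s * (1 - fps_X) ^ n - low * poly_series s)"
      unfolding num by (simp add: algebra_simps)
    then show ?thesis unfolding syz_coeff_def by simp
  qed
  also have "\<dots> = (- 1) ^ k * ((- 1) ^ (k + m) * int ((n - s) choose (k + m))) - (- 1) ^ k * (low * poly_series s) $ (k + m)"
    unfolding pn by (simp add: one_minus_X_power_nth algebra_simps)
  also have "(- 1) ^ k * ((- 1) ^ (k + m) * int ((n - s) choose (k + m))) = (- 1) ^ m * int ((n - s) choose (k + m))"
    by (simp add: power_add minus_one_power_iff)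
  also have "(low * poly_series s) $ (k + m)
      = (\<Sum>j<k. (- 1) ^ j * int (n choose j) * poly_series s $ (k + m - j))"
    unfolding fps_mult_nth by (rule sum.mono_neutral_cong_right) (auto simp: low_def)
  \<comment> \<open>Reversed, so that the sum starts at \<open>n choose (k - 1)\<close>, its
    intended leading summand.\<close>
  also have "\<dots> = (\<Sum>i<k. (- 1) ^ (k - Suc i) * int (n choose (k - Suc i)) * poly_series s $ (k + m - (k - Suc i)))"
    by (rule sum.nat_diff_reindex[symmetric])
  also have "\<dots> = (\<Sum>i<k. - ((- 1) ^ k * ((- 1) ^ i * int ((n choose (k - 1 - i)) * ((s + m + i) choose (m + 1 + i))))))"
  proof (rule sum.cong[OF refl])
    fix i assume "i \<in> {..<k}"
    then have i: "i < k" by simp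
    have "(- 1 :: int) ^ (k - Suc i) = - ((- 1) ^ k * (- 1) ^ i)"
      using i by (auto simp: minus_one_power_iff)
    moreover have "k + m - (k - Suc i) = m + 1 + i" using i by simp
    ultimately show "(- 1) ^ (k - Suc i) * int (n choose (k - Suc i)) * poly_series s $ (k + m - (k - Suc i))
      = - ((- 1) ^ k * ((- 1) ^ i * int ((n choose (k - 1 - i)) * ((s + m + i) choose (m + 1 + i)))))"
      by (simp add: poly_series_nth add.assoc)
  qed
  also have "\<dots> = - ((- 1) ^ k * (\<Sum>i<k. (- 1) ^ i * int ((n choose (k - 1 - i)) * ((s + m + i) choose (m + 1 + i)))))"
    by (simp only: sum_negf sum_distrib_left)
  finally show ?thesis by (simp add: minus_one_power_iff split: if_splits)
qed

lemma syz_series_decomposable: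
  assumes "0 < k" "k \<le> n" "0 < s" "n = r + s" and nonneg: "\<And>m. 0 \<le> syz_coeff n k s m"
  shows "decomposable r n (syz_series n k)"
proof -
  define Q where "Q = (1 - fps_X) ^ r * syz_series n k"
  have Q: "Q = poly_series s * syz_numerator n k"
    unfolding Q_def by (rule syz_series_mult_eq[OF assms(4)])
  have Q_nonneg: "0 \<le> Q $ d" for d
    using nonneg[of "d - k"] poly_series_syz_numerator_low[OF assms(1)] unfolding Q
    by (cases "d < k") (simp_all add: syz_coeff_def)
  have power_Q: "(1 - fps_X) ^ s * Q = syz_numerator n k"
    unfolding Q by (rule poly_series_cancel)
  have vanish: "eventually (\<lambda>N. ((1 - fps_X) ^ s * Q) $ N = 0) sequentially"
    unfolding power_Q eventually_sequentially
    by (rule exI[of _ "Suc n"]) (auto simp: syz_numerator_nth[OF assms(1)])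
  \<comment> \<open>This series is the numerator divided by \<open>1 - T\<close>. Only its summand
    \<open>i = 0\<close> keeps a denominator; the others are polynomials. So the coefficients are
    eventually the constant \<open>(n - 1) choose (k - 1)\<close>, which is positive as
    \<open>0 < k \<le> n\<close>.\<close>
  have last: "eventually (\<lambda>N. 1 \<le> ((1 - fps_X) ^ (s - 1) * Q) $ N) sequentially"
  proof -
    have "(1 - fps_X) ^ (s - 1) * Q = poly_series 1 * ((1 - fps_X) * ((1 - fps_X) ^ (s - 1) * Q))"
      using poly_series_cancel(1)[of 1] by simp
    also have "(1 - fps_X) * ((1 - fps_X) ^ (s - 1) * Q) = syz_numerator n k"
      using power_Q assms(3) by (cases s) (simp_all add: mult.assoc)
    also have "poly_series 1 * syz_numerator n k
        = (\<Sum>i<n. of_nat ((n - 1 - i) choose (k - 1)) * (fps_X ^ k * ((1 - fps_X) ^ i * poly_series 1)))"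
      by (simp add: syz_numerator_def sum_distrib_left mult_ac)
    also have "\<dots> = of_nat ((n - 1) choose (k - 1)) * (fps_X ^ k * poly_series 1)
        + (\<Sum>i<n - 1. of_nat ((n - 1 - Suc i) choose (k - 1)) * (fps_X ^ k * (1 - fps_X) ^ i))"
    proof -
      have "(1 - fps_X) ^ Suc i * poly_series 1 = (1 - fps_X) ^ i" for i
        using one_minus_X_power_poly_series_self[of 1] by (simp add: mult_ac)
      moreover obtain n' where "n = Suc n'" using assms(1,2) by (cases n) auto
      ultimately show ?thesis
        by (simp add: sum.lessThan_Suc_shift del: power_Suc sum.lessThan_Suc)
    qed
    finally have eq: "(1 - fps_X) ^ (s - 1) * Q = of_nat ((n - 1) choose (k - 1)) * (fps_X ^ k * poly_series 1)
        + (\<Sum>i<n - 1. of_nat ((n - 1 - Suc i) choose (k - 1)) * (fps_X ^ k * (1 - fps_X) ^ i))" .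
    have "((1 - fps_X) ^ (s - 1) * Q) $ N = int ((n - 1) choose (k - 1))" if "N \<ge> n + k" for N
    proof -
      have *: "(of_nat c * (fps_X ^ k * G)) $ N = int c * G $ (N - k)" for c and G :: "int fps"
        using that by (simp add: fps_of_nat[symmetric] fps_X_power_mult_nth)
      have "(\<Sum>i<n - 1. of_nat ((n - 1 - Suc i) choose (k - 1)) * (fps_X ^ k * (1 - fps_X :: int fps) ^ i)) $ N = 0"
        using that unfolding fps_sum_nth * by (intro sum.neutral) (auto simp: one_minus_X_power_nth)
      then show ?thesis unfolding eq fps_add_nth * by (simp add: poly_series_nth)
    qed
    moreover have "1 \<le> int ((n - 1) choose (k - 1))" using assms(1,2) by (simp add: Suc_le_eq)
    ultimately show ?thesis unfolding eventually_sequentially by (intro exI[of _ "n + k"]) simp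
  qed
  \<comment> \<open>Undoing the differences one at a time spreads positivity to all lower powers of
    \<open>1 - T\<close>.\<close>
  have down: "eventually (\<lambda>N. 1 \<le> ((1 - fps_X) ^ (s - 1 - t) * Q) $ N) sequentially" if "t < s" for t
    using that
  proof (induction t)
    case 0
    then show ?case using last by simp
  next
    case (Suc t)
    then have "s - 1 - t = Suc (s - 1 - Suc t)" by simp
    then have "(1 - fps_X) ^ (s - 1 - t) * Q = (1 - fps_X) * ((1 - fps_X) ^ (s - 1 - Suc t) * Q)"
      by (simp only: power_Suc mult.assoc)
    then have "eventually (\<lambda>N. 1 \<le> ((1 - fps_X) * ((1 - fps_X) ^ (s - 1 - Suc t) * Q)) $ N) sequentially"
      using Suc.IH Suc.prems by (metis Suc_lessD)
    then show ?case by (rule eventually_ge_1_of_difference)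
  qed
  have "eventually (\<lambda>N. 0 \<le> ((1 - fps_X) ^ i * Q) $ N) sequentially" if "i < s" for i
  proof -
    have "s - 1 - (s - 1 - i) = i" using that by simp
    then have "eventually (\<lambda>N. 1 \<le> ((1 - fps_X) ^ i * Q) $ N) sequentially"
      using down[of "s - 1 - i"] that by simp
    then show ?thesis by (rule eventually_mono) simp
  qed
  then have "eventually (\<lambda>N. decomposable 0 s (fps_shift N Q)) sequentially"
    using vanish by (rule eventually_decomposable_fps_shift)
  then obtain N where N: "decomposable 0 s (fps_shift N Q)"
    unfolding eventually_sequentially by blast
  \<comment> \<open>Below degree \<open>N\<close> nonnegativity is enough: each coefficient becomes
    that many summands of dimension 0.\<close>
  have "Q = (\<Sum>i<N. of_nat (nat (Q $ i)) * (fps_X ^ i * poly_series 0)) + fps_X ^ N * poly_series 0 * fps_shift N Q"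
  proof (rule fps_ext)
    fix d
    have "(\<Sum>i<N. of_nat (nat (Q $ i)) * (fps_X ^ i * poly_series 0)) $ d = (\<Sum>i<N. if d = i then Q $ i else 0)"
      unfolding fps_sum_nth
      by (intro sum.cong) (simp_all add: poly_series_0 Q_nonneg fps_of_nat[symmetric])
    then show "Q $ d = ((\<Sum>i<N. of_nat (nat (Q $ i)) * (fps_X ^ i * poly_series 0))
        + fps_X ^ N * poly_series 0 * fps_shift N Q) $ d"
      by (simp add: poly_series_0 fps_X_power_mult_nth)
  qed
  moreover have "decomposable 0 s (\<Sum>i<N. of_nat (nat (Q $ i)) * (fps_X ^ i * poly_series 0))"
    by (intro decomposable_sum decomposable_of_nat_mult decomposable_base) auto
  moreover have "decomposable 0 s (fps_X ^ N * poly_series 0 * fps_shift N Q)"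
    using decomposable_shift[OF N, of 0 N] by simp
  ultimately have "decomposable 0 s Q" by (metis decomposable_add)
  from decomposable_shift[OF this, of r 0] have "decomposable r n (poly_series r * Q)"
    using assms(4) by simp
  moreover have "poly_series r * Q = syz_series n k"
    unfolding Q_def by (rule poly_series_cancel)
  ultimately show ?thesis by simp
qed

section \<open>Passage between Hilbert decompositions and power series\<close>

lemma int_sum_list: "int (sum_list xs) = sum_list (map int xs)"
  by (induction xs) simp_all

lemma vdim_retract_comp_int:
  assumes "L \<subseteq> Rcomp n 1" "0 \<le> s"
  shows "int (vdim_poly (retract_comp L (int d - s))) = (fps_X ^ nat s * poly_series (retract_dim L)) $ d"
proof (cases "int d < s")
  case True
  then show ?thesis using assms by (simp add: retract_comp_neg fps_X_power_mult_nth nat_less_iff)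
next
  case False
  then obtain j where j: "int d - s = int j" using nonneg_int_cases[of "int d - s"] by auto
  then have "d - nat s = j" "\<not> d < nat s" using assms(2) by auto
  then show ?thesis
    using vdim_retract_comp[OF assms(1), of j] j by (simp add: fps_X_power_mult_nth poly_series_nth)
qed

lemma vdim_Mcomp_series:
  assumes "0 < k"
  shows "int (vdim_ext (Mcomp n k (int d) :: (nat set \<Rightarrow> 'a::field mpoly) set)) = syz_series n k $ d"
proof (cases "d < k")
  case True
  then show ?thesis by (simp add: syz_series_nth vdim_Mcomp_low)
next
  case False
  then show ?thesis using vdim_Mcomp[OF assms, of n "d - k", where ?'a = 'a]
    by (simp add: syz_series_nth)
qed

lemma hilbert_decomp_imp_decomposable:
  fixes D :: "('a::field mpoly set \<times> int) list"
  assumes "0 < k" and D: "hilbert_decomp TYPE('a) n k D" "D \<noteq> []"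
  shows "decomposable (decomp_depth D) n (syz_series n k)"
proof -
  have L: "\<And>L s. (L, s) \<in> set D \<Longrightarrow> L \<subseteq> Rcomp n 1"
    and dims: "\<And>d. vdim_ext (Mcomp n k d :: (nat set \<Rightarrow> 'a mpoly) set)
                = (\<Sum>(L, s)\<leftarrow>D. vdim_poly (retract_comp L (d - s)))"
    using D(1) by (auto simp: hilbert_decomp_def)
  \<comment> \<open>A summand with negative shift would contribute its constants in a negative
    degree, where the module vanishes. So all shifts are exponents of power series.\<close>
  have s_nonneg: "0 \<le> s" if Ls: "(L, s) \<in> set D" for L s
  proof (rule ccontr)
    assume "\<not> 0 \<le> s"
    then have "vdim_ext (Mcomp n k s :: (nat set \<Rightarrow> 'a mpoly) set) = 0"
      by (intro vdim_Mcomp_low) simp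
    then have "(\<Sum>(L, s')\<leftarrow>D. vdim_poly (retract_comp L (s - s'))) = 0" using dims by simp
    then have "vdim_poly (retract_comp L (s - s)) = 0"
      using Ls by (force simp: sum_list_eq_0_iff)
    then show False using vdim_retract_comp[OF L[OF Ls], of 0] by simp
  qed
  let ?D = "map (\<lambda>(L, s). (retract_dim L, nat s)) D"
  have "list_series ?D = syz_series n k"
  proof (rule fps_ext)
    fix d
    have "syz_series n k $ d = (\<Sum>(L, s)\<leftarrow>D. int (vdim_poly (retract_comp L (int d - s))))"
      using vdim_Mcomp_series[OF assms(1), of n d, where ?'a = 'a]
      by (simp add: dims int_sum_list case_prod_unfold comp_def)
    also have "\<dots> = (\<Sum>(L, s)\<leftarrow>D. (fps_X ^ nat s * poly_series (retract_dim L)) $ d)"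
      by (intro arg_cong[of _ _ sum_list] map_cong)
        (auto intro!: vdim_retract_comp_int[where n = n] dest: L s_nonneg)
    also have "\<dots> = list_series ?D $ d"
      unfolding list_series_def by (induction D) (auto simp: case_prod_unfold)
    finally show "list_series ?D $ d = syz_series n k $ d" by simp
  qed
  moreover have "decomp_depth D \<le> retract_dim L" if "(L, s) \<in> set D" for L s
    unfolding decomp_depth_def using that by (intro Min_le) force+
  ultimately show ?thesis
    unfolding decomposable_def using retract_dim_le[OF L] by (intro exI[of _ ?D]) auto
qed

lemma decomposable_imp_hilbert_decomp:
  assumes "0 < k" "k \<le> n" and dec: "decomposable r n (syz_series n k)"
  shows "\<exists>D. D \<noteq> [] \<and> hilbert_decomp TYPE('a::field) n k D \<and> r \<le> decomp_depth D"
proof -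
  obtain D where D: "\<And>p s. (p, s) \<in> set D \<Longrightarrow> r \<le> p \<and> p \<le> n" "list_series D = syz_series n k"
    using dec unfolding decomposable_def by blast
  \<comment> \<open>The series is nonzero, so the list is nonempty and the minimum defining its
    depth is meaningful.\<close>
  have "syz_series n k $ k \<noteq> 0"
  proof -
    have "syz_numerator n k $ k = ((1 - fps_X) ^ n * syz_series n k) $ k" by (simp add: syz_numerator_eq)
    also have "\<dots> = (\<Sum>i=0..k. ((1 - fps_X) ^ n) $ i * syz_series n k $ (k - i))" by (rule fps_mult_nth)
    also have "\<dots> = (\<Sum>i\<in>{0}. ((1 - fps_X) ^ n) $ i * syz_series n k $ (k - i))"
      by (rule sum.mono_neutral_right) (auto simp: syz_series_nth)
    finally show ?thesis using assms by (auto simp: syz_numerator_nth)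
  qed
  then have ne: "D \<noteq> []" using D(2) by (auto simp: list_series_def)
  let ?D = "map (\<lambda>(p, s). (Var ` {..<p} :: 'a mpoly set, int s)) D"
  have "vdim_ext (Mcomp n k d :: (nat set \<Rightarrow> 'a mpoly) set) = (\<Sum>(L, s)\<leftarrow>?D. vdim_poly (retract_comp L (d - s)))" for d
  proof (cases "d < 0")
    case True
    have "(\<Sum>(L, s)\<leftarrow>?D. vdim_poly (retract_comp L (d - s))) = 0"
      using True by (auto simp: sum_list_eq_0_iff intro!: retract_comp_neg)
    then show ?thesis using True vdim_Mcomp_low[of d k n, where ?'a = 'a] by simp
  next
    case False
    then obtain e where e: "d = int e" using nonneg_eq_int by (metis not_less)
    have "int (\<Sum>(L, s)\<leftarrow>?D. vdim_poly (retract_comp L (d - s)))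
        = (\<Sum>(p, s)\<leftarrow>D. int (vdim_poly (retract_comp (Var ` {..<p} :: 'a mpoly set) (int e - int s))))"
      unfolding e by (simp add: int_sum_list case_prod_unfold comp_def)
    also have "\<dots> = (\<Sum>(p, s)\<leftarrow>D. (fps_X ^ s * poly_series p) $ e)"
    proof (intro arg_cong[of _ _ sum_list] map_cong refl)
      fix x assume "x \<in> set D"
      then obtain p s where x: "x = (p, s)" "p \<le> n" using D(1) by (metis surj_pair)
      show "(case x of (p, s) \<Rightarrow> int (vdim_poly (retract_comp (Var ` {..<p} :: 'a mpoly set) (int e - int s))))
          = (case x of (p, s) \<Rightarrow> (fps_X ^ s * poly_series p) $ e)"
        using vdim_retract_comp_int[OF Var_retract(1)[OF x(2), where ?'a = 'a], of "int s" e] Var_retract(2)[OF x(2), where ?'a = 'a]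
        by (simp add: x(1))
    qed
    also have "\<dots> = list_series D $ e"
      unfolding list_series_def by (induction D) (auto simp: case_prod_unfold)
    also have "\<dots> = int (vdim_ext (Mcomp n k d :: (nat set \<Rightarrow> 'a mpoly) set))"
      unfolding D(2) e vdim_Mcomp_series[OF assms(1)] ..
    finally show ?thesis by simp
  qed
  moreover have "\<forall>(L, s)\<in>set ?D. L \<subseteq> Rcomp n 1"
    using D(1) Var_retract(1)[where ?'a = 'a] by fastforce
  ultimately have "hilbert_decomp TYPE('a) n k ?D" by (simp add: hilbert_decomp_def)
  moreover have "r \<le> decomp_depth ?D"
    unfolding decomp_depth_def using ne D(1) Var_retract(2)[where ?'a = 'a]
    by (subst Min_ge_iff) fastforce+
  ultimately show ?thesis using ne by (intro exI[of _ ?D]) simp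
qed

lemma decomp_depth_le:
  fixes D :: "('a::field mpoly set \<times> int) list"
  assumes "hilbert_decomp TYPE('a) n k D" "D \<noteq> []"
  shows "decomp_depth D \<le> n"
proof -
  obtain L s where "(L, s) \<in> set D" using assms(2) by (cases D) auto
  then have "decomp_depth D \<le> retract_dim L"
    unfolding decomp_depth_def by (intro Min_le) force+
  moreover have "L \<subseteq> Rcomp n 1" using \<open>(L, s) \<in> set D\<close> assms(1) by (auto simp: hilbert_decomp_def)
  ultimately show ?thesis using retract_dim_le order_trans by blast
qed

lemma Hdepth1_bounds:
  assumes "0 < k" "k \<le> n"
  shows Hdepth1_ge: "decomposable r n (syz_series n k) \<Longrightarrow> r \<le> Hdepth1 TYPE('a::field) n k"
    and Hdepth1_decomposable: "decomposable (Hdepth1 TYPE('a) n k) n (syz_series n k)"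
    and Hdepth1_le: "Hdepth1 TYPE('a) n k \<le> n"
proof -
  let ?A = "{decomp_depth D | D. D \<noteq> [] \<and> hilbert_decomp TYPE('a) n k D}"
  have "?A \<subseteq> {..n}" using decomp_depth_le by blast
  then have fin: "finite ?A" using finite_subset by blast
  \<comment> \<open>The formula for the Hilbert series is itself a decomposition; hence the maximum
    is taken over a nonempty set.\<close>
  have "decomposable 0 n (syz_series n k)"
    unfolding syz_series_def
    by (intro decomposable_sum decomposable_of_nat_mult decomposable_base) auto
  then have "?A \<noteq> {}" using decomposable_imp_hilbert_decomp[OF assms, of 0, where ?'a = 'a] by blast
  then have "Hdepth1 TYPE('a) n k \<in> ?A" unfolding Hdepth1_def by (intro Max_in fin)
  then obtain D where D: "Hdepth1 TYPE('a) n k = decomp_depth D" "D \<noteq> []" "hilbert_decomp TYPE('a) n k D"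
    by blast
  then show "decomposable (Hdepth1 TYPE('a) n k) n (syz_series n k)"
    using hilbert_decomp_imp_decomposable[OF assms(1)] by metis
  show "Hdepth1 TYPE('a) n k \<le> n" using D decomp_depth_le by metis
  assume "decomposable r n (syz_series n k)"
  then obtain D' where D': "D' \<noteq> []" "hilbert_decomp TYPE('a) n k D'" "r \<le> decomp_depth D'"
    using decomposable_imp_hilbert_decomp[OF assms, where ?'a = 'a] by blast
  then have "decomp_depth D' \<in> ?A" by blast
  then have "decomp_depth D' \<le> Hdepth1 TYPE('a) n k" unfolding Hdepth1_def by (intro Max_ge fin)
  then show "r \<le> Hdepth1 TYPE('a) n k" using D'(3) by simp
qed

lemma Hdepth1_ge_if_coeffs_nonneg:
  assumes "0 < k" "k \<le> n" "0 < s" "s \<le> n" "\<And>m. 0 \<le> syz_coeff n k s m"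
  shows "n - s \<le> Hdepth1 TYPE('a::field) n k"
proof (rule Hdepth1_ge[OF assms(1,2)])
  show "decomposable (n - s) n (syz_series n k)"
    by (rule syz_series_decomposable[OF assms(1-3) _ assms(5)]) (use assms(4) in simp)
qed

lemma Hdepth1_less_if_coeff_neg:
  assumes "0 < k" "k \<le> n" "s \<le> n" and neg: "syz_coeff n k s m < 0"
  shows "Hdepth1 TYPE('a::field) n k < n - s"
proof (rule ccontr)
  let ?h = "Hdepth1 TYPE('a) n k"
  assume "\<not> ?h < n - s"
  then obtain q where q: "?h = (n - s) + q" using le_Suc_ex not_less by metis
  have "decomposable ?h n (syz_series n k)" by (rule Hdepth1_decomposable[OF assms(1,2)])
  then have "decomposable (n - s) n (syz_series n k)"
    unfolding decomposable_def q by fastforce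
  then have "0 \<le> ((1 - fps_X) ^ (n - s) * syz_series n k) $ (k + m)" by (rule decomposable_nonneg)
  also have "\<dots> = syz_coeff n k s m"
    using assms(3) by (simp add: syz_coeff_def syz_series_mult_eq[of n "n - s" s])
  finally show False using neg by simp
qed

section \<open>Signs of the coefficients\<close>

text \<open>The Leibniz estimates. Sequences are infinite here, so the finite lists of summands
  below are extended by 0.\<close>

lemma alternating_sum_bounds:
  fixes a :: "nat \<Rightarrow> int"
  assumes "\<And>i. 0 \<le> a i" "\<And>i. a (Suc i) \<le> a i"
  shows "0 \<le> (\<Sum>i<N. (- 1) ^ i * a i)" "(\<Sum>i<N. (- 1) ^ i * a i) \<le> a 0"
    and "a 0 - a 1 \<le> (\<Sum>i<Suc N. (- 1) ^ i * a i)"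
proof -
  have shift: "(\<Sum>i<Suc N. (- 1) ^ i * a i) = a 0 - (\<Sum>i<N. (- 1) ^ i * a (Suc i))" for N and a :: "nat \<Rightarrow> int"
    by (simp add: sum.lessThan_Suc_shift sum_negf del: sum.lessThan_Suc)
  have bounds: "0 \<le> (\<Sum>i<N. (- 1) ^ i * a i) \<and> (\<Sum>i<N. (- 1) ^ i * a i) \<le> a 0"
    if "\<And>i. 0 \<le> a i" "\<And>i. a (Suc i) \<le> a i" for N and a :: "nat \<Rightarrow> int"
    using that
  proof (induction N arbitrary: a)
    case (Suc N)
    have "0 \<le> (\<Sum>i<N. (- 1) ^ i * a (Suc i))" "(\<Sum>i<N. (- 1) ^ i * a (Suc i)) \<le> a 1"
      using Suc.IH[of "\<lambda>i. a (Suc i)"] Suc.prems by simp_all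
    then show ?case using Suc.prems(2)[of 0] unfolding shift by simp
  qed simp
  show "0 \<le> (\<Sum>i<N. (- 1) ^ i * a i)" "(\<Sum>i<N. (- 1) ^ i * a i) \<le> a 0"
    using bounds assms by blast+
  have "(\<Sum>i<N. (- 1) ^ i * a (Suc i)) \<le> a 1"
    using bounds[of "\<lambda>i. a (Suc i)" N] assms by simp
  then show "a 0 - a 1 \<le> (\<Sum>i<Suc N. (- 1) ^ i * a i)" unfolding shift by simp
qed

lemma choose_Suc_mult: "Suc j * (n choose Suc j) = (n - j) * (n choose j)"
  by (metis binomial_absorb_comp binomial_absorption)

text \<open>Multiplying by \<open>m\<close> separates the two factors, whose quotients both decrease in \<open>i\<close>.\<close>
lemma upper_summands_decreasing:
  assumes "0 < s" "i < m" and le: "(n - k) * m \<le> (k + 1) * (s - 1 + m)"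
  shows "(n choose (k + Suc i)) * ((s + (m - Suc i) - 1) choose (m - Suc i))
    \<le> (n choose (k + i)) * ((s + (m - i) - 1) choose (m - i))"
proof -
  obtain p where p: "s = Suc p" using assms(1) by (cases s) auto
  obtain q where q: "m = Suc (i + q)" using assms(2) less_imp_Suc_add by blast
  have "(n - k - i) * Suc q * m \<le> (k + Suc i) * (p + Suc q) * m"
  proof -
    have "(n - k - i) * Suc q * m \<le> ((n - k) * m) * Suc q" by (simp add: algebra_simps)
    also have "\<dots> \<le> ((k + 1) * (p + m)) * Suc q" using le p by (intro mult_right_mono) auto
    also have "\<dots> = (k + 1) * ((p + m) * Suc q)" by (simp only: mult.assoc)
    also have "\<dots> \<le> (k + 1) * (m * (p + Suc q))"
      by (intro mult_left_mono) (simp_all add: q algebra_simps)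
    also have "\<dots> \<le> (k + Suc i) * (m * (p + Suc q))" by (intro mult_right_mono) auto
    finally show ?thesis by (simp only: mult_ac)
  qed
  then have key: "(n - k - i) * Suc q \<le> (k + Suc i) * (p + Suc q)" using q by (simp del: mult_Suc mult_Suc_right)
  let ?A = "n choose (k + i)" and ?A' = "n choose Suc (k + i)"
  let ?B = "Suc (p + q) choose Suc q" and ?B' = "(p + q) choose q"
  have A: "Suc (k + i) * ?A' = (n - k - i) * ?A" using choose_Suc_mult[of "k + i" n] by simp
  have B: "Suc q * ?B = Suc (p + q) * ?B'" by (rule Suc_times_binomial)
  have "(Suc (k + i) * Suc (p + q)) * (?A' * ?B') = (Suc (k + i) * ?A') * (Suc (p + q) * ?B')"
    by (simp only: mult_ac)
  also have "\<dots> = ((n - k - i) * Suc q) * (?A * ?B)" unfolding A B[symmetric] by (simp only: mult_ac)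
  also have "\<dots> \<le> ((k + Suc i) * (p + Suc q)) * (?A * ?B)" using key by (rule mult_right_mono) simp
  finally have "(Suc (k + i) * Suc (p + q)) * (?A' * ?B') \<le> (Suc (k + i) * Suc (p + q)) * (?A * ?B)"
    by simp
  then have "?A' * ?B' \<le> ?A * ?B" by (simp del: mult_Suc mult_Suc_right binomial_Suc_Suc)
  moreover have "s + (m - Suc i) - 1 = p + q" "m - Suc i = q" "s + (m - i) - 1 = Suc (p + q)" "m - i = Suc q"
    using p q by simp_all
  ultimately show ?thesis by (simp del: binomial_Suc_Suc)
qed

text \<open>The quotient of consecutive summands, cross-multiplied. It serves both for their
  monotonicity and for the gap between the first two.\<close>

lemma lower_summand_step:
  assumes "Suc i < k"
  shows "((n choose (k - 1 - Suc i)) * ((s + m + Suc i) choose (m + 1 + Suc i))) * ((n - (k - 2 - i)) * (m + 2 + i))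
    = ((n choose (k - 1 - i)) * ((s + m + i) choose (m + 1 + i))) * ((k - 1 - i) * (s + m + i + 1))"
proof -
  obtain j where j: "k = Suc (Suc (i + j))" using assms by (metis less_imp_Suc_add add_Suc)
  let ?A = "n choose Suc j" and ?A' = "n choose j"
  let ?B = "(s + m + i) choose (m + 1 + i)" and ?B' = "Suc (s + m + i) choose Suc (m + 1 + i)"
  have A: "Suc j * ?A = (n - j) * ?A'" by (rule choose_Suc_mult)
  have B: "Suc (m + 1 + i) * ?B' = Suc (s + m + i) * ?B" by (rule Suc_times_binomial)
  have "(?A' * ?B') * ((n - j) * Suc (m + 1 + i)) = ((n - j) * ?A') * (Suc (m + 1 + i) * ?B')"
    by (simp only: mult_ac)
  also have "\<dots> = (?A * ?B) * (Suc j * Suc (s + m + i))" unfolding A[symmetric] B by (simp only: mult_ac)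
  finally show ?thesis using j by (simp del: binomial_Suc_Suc mult_Suc mult_Suc_right)
qed

text \<open>The last hypothesis is the comparison at \<open>i = 0\<close>. As \<open>i\<close>
  grows, the numerator of the quotient gains at most as much as the denominator, because
  \<open>2k \<le> n + s\<close>; this is computed in the integers since the gain of the numerator
  may be negative.\<close>

lemma lower_summands_decreasing:
  assumes "Suc i < k" "k \<le> n" "2 * k \<le> n + s"
    and le: "(k - 1) * (s + m + 1) \<le> (n - k + 2) * (m + 2)"
  shows "(n choose (k - 1 - Suc i)) * ((s + m + Suc i) choose (m + 1 + Suc i))
    \<le> (n choose (k - 1 - i)) * ((s + m + i) choose (m + 1 + i))"
proof -
  obtain j where j: "k = Suc (Suc (i + j))" using assms(1) by (metis less_imp_Suc_add add_Suc)
  obtain r where r: "n = k + r" using assms(2) le_Suc_ex by blast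
  have "Suc j * (s + m + i + 1) \<le> (n - j) * (m + 2 + i)"
  proof -
    have "int (Suc j * (s + m + i + 1)) = int ((k - 1) * (s + m + 1)) + int i * (int j + 1 - int (s + m + 1))"
      using j by (simp add: algebra_simps)
    also have "\<dots> \<le> int ((n - k + 2) * (m + 2)) + int i * (int r + int m + 4 + int i)"
    proof (intro add_mono mult_left_mono)
      show "int ((k - 1) * (s + m + 1)) \<le> int ((n - k + 2) * (m + 2))" using le by linarith
      show "int j + 1 - int (s + m + 1) \<le> int r + int m + 4 + int i" using assms(3) j r by simp
    qed simp
    also have "\<dots> = int ((n - j) * (m + 2 + i))" using j r by (simp add: algebra_simps)
    finally show ?thesis by linarith
  qed
  moreover have "k - 1 - i = Suc j" "k - 2 - i = j" "0 < n - j" using j r by simp_all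
  ultimately have "((n choose (k - 1 - Suc i)) * ((s + m + Suc i) choose (m + 1 + Suc i))) * ((n - j) * (m + 2 + i))
      \<le> ((n choose (k - 1 - i)) * ((s + m + i) choose (m + 1 + i))) * ((n - j) * (m + 2 + i))"
    using lower_summand_step[OF assms(1), of n s m] by (metis mult_le_mono2)
  then show ?thesis using \<open>0 < n - j\<close> by (metis mult_le_cancel2 nat_0_less_mult_iff add_gr_0 zero_less_numeral)
qed

definition lower_sum :: "nat \<Rightarrow> nat \<Rightarrow> nat \<Rightarrow> nat \<Rightarrow> int" where
  "lower_sum n k s m = (\<Sum>i<k. (- 1) ^ i * int ((n choose (k - 1 - i)) * ((s + m + i) choose (m + 1 + i))))"

lemma lower_sum_bounds:
  assumes "0 < k" "k \<le> n" "2 * k \<le> n + s"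
    and le: "(k - 1) * (s + m + 1) \<le> (n - k + 2) * (m + 2)"
  shows lower_sum_nonneg: "0 \<le> lower_sum n k s m"
    and lower_sum_le: "lower_sum n k s m \<le> int ((n choose (k - 1)) * ((s + m) choose (m + 1)))"
    and lower_sum_ge: "(k - 1) * (s + m + 1) < (n - k + 2) * (m + 2) \<Longrightarrow>
      int ((n choose (k - 1)) * ((s + m) choose (m + 1))) \<le> lower_sum n k s m * int ((n - k + 2) * (m + 2))"
proof -
  define a where "a i = (if i < k then int ((n choose (k - 1 - i)) * ((s + m + i) choose (m + 1 + i))) else 0)" for i
  have a0: "a 0 = int ((n choose (k - 1)) * ((s + m) choose (m + 1)))" using assms(1) by (simp add: a_def)
  have nonneg: "0 \<le> a i" for i by (simp add: a_def)
  have dec: "a (Suc i) \<le> a i" for i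
  proof (cases "Suc i < k")
    case True
    then show ?thesis using lower_summands_decreasing[OF True assms(2-4)] by (simp only: a_def Suc_lessD if_True)
  qed (simp add: a_def)
  have eq: "lower_sum n k s m = (\<Sum>i<k. (- 1) ^ i * a i)"
    unfolding lower_sum_def by (intro sum.cong) (simp_all add: a_def)
  show "0 \<le> lower_sum n k s m" "lower_sum n k s m \<le> int ((n choose (k - 1)) * ((s + m) choose (m + 1)))"
    using alternating_sum_bounds(1,2)[of a k, OF nonneg dec] eq a0 by auto
  assume lt: "(k - 1) * (s + m + 1) < (n - k + 2) * (m + 2)"
  let ?c = "int ((n - k + 2) * (m + 2))"
  have "a 1 * ?c = a 0 * int ((k - 1) * (s + m + 1))"
  proof (cases "1 < k")
    case True
    then have n: "n - (k - 2) = n - k + 2" using assms(2) by simp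
    let ?X = "(n choose (k - 1 - Suc 0)) * ((s + m + Suc 0) choose (m + 1 + Suc 0))"
    have "a 1 = int ?X" using True by (simp add: a_def)
    moreover have "?X * ((n - k + 2) * (m + 2))
        = ((n choose (k - 1)) * ((s + m) choose (m + 1))) * ((k - 1) * (s + m + 1))"
      using lower_summand_step[of 0 k n s m] True by (simp only: diff_zero add_0_right n One_nat_def)
    ultimately show ?thesis unfolding a0 by (metis of_nat_mult)
  next
    case False
    then show ?thesis using assms(1) by (simp add: a_def)
  qed
  \<comment> \<open>A strict inequality between integers leaves a gap of at least 1, so
    \<open>a 0 - a 1\<close> is at least \<open>a 0\<close> divided by \<open>?c\<close>: only a
    polynomial factor is lost.\<close>
  then have "(a 0 - a 1) * ?c = a 0 * (?c - int ((k - 1) * (s + m + 1)))" by (simp only: algebra_simps)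
  moreover have "1 \<le> ?c - int ((k - 1) * (s + m + 1))" using lt by linarith
  ultimately have "a 0 \<le> (a 0 - a 1) * ?c" using nonneg[of 0] by (metis mult.right_neutral mult_left_mono)
  also have "\<dots> \<le> lower_sum n k s m * ?c"
  proof (rule mult_right_mono)
    obtain N where "k = Suc N" using assms(1) by (cases k) auto
    then show "a 0 - a 1 \<le> lower_sum n k s m"
      using alternating_sum_bounds(3)[of a N, OF nonneg dec] eq by simp
  qed simp
  finally show "int ((n choose (k - 1)) * ((s + m) choose (m + 1))) \<le> lower_sum n k s m * ?c" using a0 by simp
qed

text \<open>The leading summand of the lower sum agrees with \<open>C(n,k) C(s+m,m)\<close> up to
  polynomial factors, so a single exponential rate serves for both signs of the coefficient.\<close>

lemma first_summand_eq:
  assumes "0 < k" "k \<le> n"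
  shows "((n choose (k - 1)) * ((s + m) choose (m + 1))) * ((n - k + 1) * (m + 1))
    = (k * s) * ((n choose k) * ((s + m) choose m))"
proof -
  obtain j where j: "k = Suc j" using assms(1) by (cases k) auto
  have A: "Suc j * (n choose Suc j) = (n - j) * (n choose j)" by (rule choose_Suc_mult)
  have B: "Suc m * ((s + m) choose Suc m) = s * ((s + m) choose m)" using choose_Suc_mult[of m "s + m"] by simp
  have "((n choose j) * ((s + m) choose Suc m)) * ((n - j) * Suc m)
      = ((n - j) * (n choose j)) * (Suc m * ((s + m) choose Suc m))" by (simp only: mult_ac)
  also have "\<dots> = (Suc j * s) * ((n choose Suc j) * ((s + m) choose m))"
    unfolding A[symmetric] B by (simp only: mult_ac)
  moreover have "n - k + 1 = n - j" using assms(2) j by simp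
  ultimately show ?thesis using j by (simp del: binomial_Suc_Suc mult_Suc mult_Suc_right)
qed

text \<open>Whichever of the two alternating sums for the coefficient has decreasing summands is used.\<close>
lemma syz_coeff_nonneg:
  assumes "0 < k" "k \<le> n" "0 < s" "s \<le> n" "2 * k \<le> n + s"
    and dom: "\<And>m. k + m \<le> n - s \<Longrightarrow>
      (n + 2) ^ 4 * ((n - s) choose (k + m)) \<le> (n choose k) * ((s + m) choose m)"
  shows "0 \<le> syz_coeff n k s m"
proof (cases "(n - k) * m \<le> (k + 1) * (s - 1 + m)")
  case True
  define b where "b i = (if i \<le> m then int ((n choose (k + i)) * ((s + (m - i) - 1) choose (m - i))) else 0)" for i
  have "b (Suc i) \<le> b i" for i
  proof (cases "i < m")
    case im: True
    then show ?thesis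
      using upper_summands_decreasing[OF assms(3) im True] by (simp only: b_def Suc_leI less_imp_le if_True)
  qed (simp add: b_def)
  then have "0 \<le> (\<Sum>i<Suc m. (- 1) ^ i * b i)" by (intro alternating_sum_bounds(1)) (simp_all add: b_def)
  also have "\<dots> = syz_coeff n k s m"
    unfolding syz_coeff_upper[OF assms(1)] by (intro sum.cong) (simp_all add: b_def)
  finally show ?thesis .
next
  case False
  \<comment> \<open>Failure of the criterion for the upper sum gives that for the lower sum, even
    strictly; the remaining linear terms are controlled by \<open>2k \<le> n + s\<close>.\<close>
  have lt: "(k - 1) * (s + m + 1) < (n - k + 2) * (m + 2)"
  proof -
    obtain j where j: "k = Suc j" using assms(1) by (cases k) auto
    obtain p where p: "s = Suc p" using assms(3) by (cases s) auto
    obtain r where r: "n = k + r" using assms(2) le_Suc_ex by blast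
    have "(Suc j + 1) * (p + m) < r * m" using False j p r by simp
    moreover have "j + 1 \<le> r + p + 1" using assms(5) j p r by simp
    ultimately show ?thesis using j p r by (simp add: algebra_simps)
  qed
  have coeff: "syz_coeff n k s m = (- 1) ^ m * int ((n - s) choose (k + m)) + lower_sum n k s m"
    unfolding syz_coeff_lower[OF assms(1,4)] lower_sum_def ..
  have A_nonneg: "0 \<le> lower_sum n k s m"
    using lower_sum_nonneg[OF assms(1,2,5)] lt by simp
  show ?thesis
  proof (cases "even m \<or> n - s < k + m")
    case True
    then show ?thesis using A_nonneg unfolding coeff by (auto simp: binomial_eq_0)
  next
    case m: False
    then have km: "k + m \<le> n - s" by simp
    let ?t = "(n choose (k - 1)) * ((s + m) choose (m + 1))"
    let ?C = "(n - s) choose (k + m)"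
    let ?d = "((n - k + 2) * (m + 2)) * ((n - k + 1) * (m + 1))"
    \<comment> \<open>The fourth power in \<open>dom\<close>: two linear factors come from the gap
      in \<open>lower_sum_ge\<close>, two from \<open>first_summand_eq\<close>.\<close>
    have "?d \<le> ((n + 2) * (n + 2)) * ((n + 2) * (n + 2))"
      using km assms by (intro mult_mono) auto
    also have "\<dots> = (n + 2) ^ 4" by (simp only: power4_eq_xxxx mult_ac)
    finally have "?d * ?C \<le> (n + 2) ^ 4 * ?C" by (rule mult_right_mono) simp
    also have "\<dots> \<le> (n choose k) * ((s + m) choose m)" by (rule dom[OF km])
    also have "\<dots> \<le> (k * s) * ((n choose k) * ((s + m) choose m))" using assms by simp
    also have "\<dots> = ?t * ((n - k + 1) * (m + 1))" by (rule first_summand_eq[OF assms(1,2), symmetric])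
    finally have "int (?d * ?C) \<le> int ?t * int ((n - k + 1) * (m + 1))" by (metis of_nat_mono of_nat_mult)
    also have "\<dots> \<le> (lower_sum n k s m * int ((n - k + 2) * (m + 2))) * int ((n - k + 1) * (m + 1))"
      using lower_sum_ge[OF assms(1,2,5) _ lt] lt by (intro mult_right_mono) auto
    finally have "int ?d * int ?C \<le> int ?d * lower_sum n k s m" by (simp only: of_nat_mult mult_ac)
    moreover have "0 < int ?d"
      by (simp only: of_nat_0_less_iff nat_0_less_mult_iff add_gr_0 zero_less_numeral zero_less_one simp_thms)
    ultimately have "int ?C \<le> lower_sum n k s m" by (metis mult_le_cancel_left_pos)
    then show ?thesis using m unfolding coeff by simp
  qed
qed

text \<open>For odd \<open>m\<close> the isolated binomial coefficient enters negatively, against a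
  lower sum that is at most its leading summand. The hypothesis \<open>le\<close> makes the lower
  summands decrease and also forces \<open>2k \<le> n\<close>; the factor \<open>n ^ 2\<close>
  bounds \<open>k * s\<close>.\<close>

lemma syz_coeff_neg:
  assumes "0 < k" "k \<le> n" "s \<le> n" "odd m" and le: "k * (s + m) \<le> (n - k) * m"
    and dom: "n ^ 2 * ((n choose k) * ((s + m) choose m)) < (n - s) choose (k + m)"
  shows "syz_coeff n k s m < 0"
proof -
  have "k * m \<le> (n - k) * m" by (rule order_trans[OF _ le]) simp
  moreover have "0 < m" using assms(4) by (cases m) auto
  ultimately have kn: "k \<le> n - k" by simp
  have "(k - 1) * (s + m + 1) \<le> k * (s + m) + k"
    by (cases k) (simp_all add: algebra_simps)
  also have "\<dots> \<le> (n - k) * m + 2 * (n - k)" using le kn by simp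
  also have "\<dots> \<le> (n - k + 2) * (m + 2)" by simp
  finally have le': "(k - 1) * (s + m + 1) \<le> (n - k + 2) * (m + 2)" .
  let ?t = "(n choose (k - 1)) * ((s + m) choose (m + 1))"
  have "?t \<le> ?t * ((n - k + 1) * (m + 1))" by simp
  also have "\<dots> = (k * s) * ((n choose k) * ((s + m) choose m))" by (rule first_summand_eq[OF assms(1,2)])
  also have "\<dots> \<le> n ^ 2 * ((n choose k) * ((s + m) choose m))"
    unfolding power2_eq_square using assms by (intro mult_right_mono mult_mono) auto
  finally have "int ?t < int ((n - s) choose (k + m))" using dom by linarith
  moreover have "lower_sum n k s m \<le> int ?t"
    using lower_sum_le[OF assms(1,2) _ le'] kn by linarith
  ultimately show ?thesis
    using assms(4) unfolding syz_coeff_lower[OF assms(1,3)] lower_sum_def[symmetric] by simp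
qed

section \<open>Exponential rates\<close>

text \<open>The logarithm of \<open>selfpow\<close>; its value 0 at 0 matches the convention
  \<open>0^0 = 1\<close>.\<close>

definition xlnx :: "real \<Rightarrow> real" where
  "xlnx x = x * ln x"

lemma xlnx_0_1 [simp]: "xlnx 0 = 0" "xlnx 1 = 0"
  by (simp_all add: xlnx_def)

lemma continuous_on_xlnx: "continuous_on {0..} xlnx"
proof -
  have "((\<lambda>x::real. x * ln x) \<longlongrightarrow> 0) (at_right 0)" by real_asymp
  then have "(xlnx \<longlongrightarrow> xlnx 0) (at 0 within {0..})"
    by (simp add: xlnx_def[abs_def] at_within_Ici_at_right)
  moreover have "(xlnx \<longlongrightarrow> xlnx x) (at x within {0..})" if "x > 0" for x
    unfolding xlnx_def using that by (intro tendsto_intros) auto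
  ultimately show ?thesis
    unfolding continuous_on_def by (metis atLeast_iff less_eq_real_def)
qed

lemma tendsto_xlnx:
  assumes "(f \<longlongrightarrow> x) F" "0 \<le> x" "eventually (\<lambda>n. 0 \<le> f n) F"
  shows "((\<lambda>n. xlnx (f n)) \<longlongrightarrow> xlnx x) F"
  by (rule continuous_on_tendsto_compose[OF continuous_on_xlnx assms(1)]) (use assms in auto)

lemma DERIV_xlnx:
  assumes "0 < x"
  shows "(xlnx has_real_derivative (ln x + 1)) (at x)"
  unfolding xlnx_def[abs_def] using assms by (auto intro!: derivative_eq_intros)

lemma selfpow_eq_exp: "0 \<le> x \<Longrightarrow> selfpow x = exp (xlnx x)"
  by (simp add: selfpow_def xlnx_def powr_def)

lemma exp_xlnx_of_nat: "exp (xlnx (real a)) = real (a ^ a)"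
  by (cases "a = 0") (simp_all add: xlnx_def exp_of_nat_mult)

lemma xlnx_scale:
  assumes "0 < c" "0 \<le> x"
  shows "xlnx (c * x) = c * xlnx x + (c * x) * ln c"
  using assms by (cases "x = 0") (simp_all add: xlnx_def ln_mult algebra_simps)

text \<open>The left side is one summand in the expansion of \<open>(b + (a - b))^a\<close>.\<close>

lemma binomial_power_le: "b \<le> a \<Longrightarrow> (a choose b) * (b ^ b * (a - b) ^ (a - b)) \<le> a ^ a"
proof -
  assume "b \<le> a"
  then have "a ^ a = (b + (a - b)) ^ a" by simp
  also have "\<dots> = (\<Sum>i\<le>a. (a choose i) * b ^ i * (a - b) ^ (a - i))" by (rule binomial_ring[where ?'a = nat, simplified])
  finally have eq: "a ^ a = (\<Sum>i\<le>a. (a choose i) * b ^ i * (a - b) ^ (a - i))" .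
  have "(a choose b) * b ^ b * (a - b) ^ (a - b) \<le> a ^ a"
    unfolding eq using \<open>b \<le> a\<close> by (intro member_le_sum[of b "{..a}"]) auto
  then show ?thesis by (simp only: mult.assoc)
qed

text \<open>The summand of index \<open>b\<close> is the largest of the \<open>a + 1\<close> summands in the expansion of
  \<open>(b + (a - b))\<^sup>a\<close>.\<close>
lemma power_le_binomial:
  assumes "b \<le> a"
  shows "a ^ a \<le> (a + 1) * ((a choose b) * (b ^ b * (a - b) ^ (a - b)))"
proof -
  define c where "c = a - b"
  define T where "T i = (a choose i) * b ^ i * c ^ (a - i)" for i
  have up: "T i \<le> T (Suc i)" if i: "i < b" for i
  proof -
    have "Suc i * ((a choose i) * c) \<le> Suc i * ((a choose Suc i) * b)"
    proof -
      have "Suc i * ((a choose i) * c) \<le> b * ((a choose i) * (a - i))"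
        using i assms by (intro mult_mono) (auto simp: c_def)
      also have "\<dots> = b * (Suc i * (a choose Suc i))" by (simp only: choose_Suc_mult mult_ac)
      finally show ?thesis by (simp only: mult_ac)
    qed
    then have "(a choose i) * c \<le> (a choose Suc i) * b" by (simp del: mult_Suc)
    then have "((a choose i) * c) * (b ^ i * c ^ (a - Suc i)) \<le> ((a choose Suc i) * b) * (b ^ i * c ^ (a - Suc i))"
      by (rule mult_right_mono) simp
    moreover have "a - i = Suc (a - Suc i)" using i assms by simp
    ultimately show ?thesis by (simp add: T_def mult_ac)
  qed
  have down: "T (Suc i) \<le> T i" if i: "b \<le> i" "i < a" for i
  proof -
    have "Suc i * ((a choose Suc i) * b) \<le> Suc i * ((a choose i) * c)"
    proof -
      have "Suc i * ((a choose Suc i) * b) = (a - i) * (a choose i) * b" by (simp only: choose_Suc_mult flip: mult.assoc)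
      also have "\<dots> \<le> c * (a choose i) * Suc i" using i by (intro mult_mono) (auto simp: c_def)
      finally show ?thesis by (simp only: mult_ac)
    qed
    then have "(a choose Suc i) * b \<le> (a choose i) * c" by (simp del: mult_Suc)
    then have "((a choose Suc i) * b) * (b ^ i * c ^ (a - Suc i)) \<le> ((a choose i) * c) * (b ^ i * c ^ (a - Suc i))"
      by (rule mult_right_mono) simp
    moreover have "a - i = Suc (a - Suc i)" using i by simp
    ultimately show ?thesis by (simp add: T_def mult_ac)
  qed
  have max: "T i \<le> T b" if "i \<le> a" for i
  proof (cases "i \<le> b")
    case True
    then show ?thesis
    proof (induction rule: inc_induct)
      case (step j)
      then show ?case using up[of j] by linarith
    qed simp
  next
    case False
    then have "b \<le> i" by simp
    then show ?thesis using \<open>i \<le> a\<close>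
    proof (induction rule: dec_induct)
      case (step j)
      then show ?case using down[of j] by linarith
    qed simp
  qed
  have "a ^ a = (b + c) ^ a" using assms by (simp add: c_def)
  also have "\<dots> = (\<Sum>i\<le>a. T i)" unfolding T_def by (rule binomial_ring[where ?'a = nat, simplified])
  also have "\<dots> \<le> (\<Sum>i\<le>a. T b)" by (intro sum_mono max) simp
  also have "\<dots> = (a + 1) * T b" by simp
  finally show ?thesis by (simp only: T_def c_def mult.assoc)
qed

text \<open>For \<open>b \<le> a\<close>, the logarithm of \<open>a^a / (b^b (a-b)^(a-b))\<close>,
  that is, \<open>a\<close> times the natural-log binary entropy of \<open>b/a\<close> when
  \<open>0 < a\<close>.\<close>

definition entropy :: "nat \<Rightarrow> nat \<Rightarrow> real" where
  "entropy a b = xlnx (real a) - xlnx (real b) - xlnx (real a - real b)"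

lemma exp_entropy:
  assumes "b \<le> a"
  shows "exp (entropy a b) * real (b ^ b * (a - b) ^ (a - b)) = real (a ^ a)"
proof -
  have "real a - real b = real (a - b)" using assms by (simp add: of_nat_diff)
  then have "exp (entropy a b) = real (a ^ a) / real (b ^ b) / real ((a - b) ^ (a - b))"
    unfolding entropy_def exp_diff by (simp only: exp_xlnx_of_nat)
  then show ?thesis by simp
qed

lemma binomial_entropy_bounds:
  assumes "b \<le> a"
  shows binomial_le_exp_entropy: "real (a choose b) \<le> exp (entropy a b)"
    and exp_entropy_le_binomial: "exp (entropy a b) \<le> real (a + 1) * real (a choose b)"
proof -
  let ?w = "b ^ b * (a - b) ^ (a - b)"
  have "0 < x ^ x" for x :: nat by (cases x) simp_all
  then have w: "0 < real ?w" by (simp only: of_nat_0_less_iff nat_0_less_mult_iff simp_thms)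
  have "real (a choose b) * real ?w \<le> exp (entropy a b) * real ?w"
    unfolding exp_entropy[OF assms] using binomial_power_le[OF assms] by (metis of_nat_mono of_nat_mult)
  then show "real (a choose b) \<le> exp (entropy a b)" using w by (rule mult_right_le_imp_le)
  have "exp (entropy a b) * real ?w \<le> (real (a + 1) * real (a choose b)) * real ?w"
    unfolding exp_entropy[OF assms] using power_le_binomial[OF assms] by (metis of_nat_mono of_nat_mult mult.assoc)
  then show "exp (entropy a b) \<le> real (a + 1) * real (a choose b)" using w by (rule mult_right_le_imp_le)
qed

text \<open>The logarithm of the left-hand side of the equation for \<open>\<gamma>\<close>, at arbitrary \<open>\<alpha>\<close>: the
  exponential rate of the quotient of \<open>C(n,k) C(s+m,m)\<close> by \<open>C(n-s,k+m)\<close>.\<close>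
definition rate :: "real \<Rightarrow> real \<Rightarrow> real \<Rightarrow> real" where
  "rate a b g = xlnx (a + g) + xlnx (a + b) + xlnx (1 - a - b - g)
     - xlnx a - xlnx b - xlnx g - xlnx (1 - b) - xlnx (1 - g)"

text \<open>Scaling by \<open>n\<close> produces terms with \<open>ln n\<close>, but they cancel
  within each entropy because \<open>a = b + (a - b)\<close>.\<close>

lemma entropy_rate:
  assumes n: "0 < n" and km: "k + m + s \<le> n"
  shows "entropy n k + entropy (s + m) m - entropy (n - s) (k + m)
    = real n * rate (real m / real n) (real k / real n) (real s / real n)"
proof -
  let ?N = "real n"
  define a b g where "a = real m / ?N" and "b = real k / ?N" and "g = real s / ?N"
  have N: "0 < ?N" using n by simp
  have nonneg: "0 \<le> a" "0 \<le> b" "0 \<le> g" by (simp_all add: a_def b_def g_def)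
  have "real (k + m + s) \<le> ?N" using km by (rule of_nat_mono)
  then have "a + b + g \<le> 1" unfolding a_def b_def g_def using N by (simp add: field_simps)
  then have le1: "0 \<le> 1 - b" "0 \<le> 1 - g" "0 \<le> 1 - a - b - g" using nonneg by linarith+
  have mult: "real m = ?N * a" "real k = ?N * b" "real s = ?N * g"
    using N by (simp_all add: a_def b_def g_def)
  have sub: "real (n - s) = ?N * (1 - g)" using km mult by (simp add: of_nat_diff algebra_simps)
  have X: "xlnx (?N * x) = ?N * xlnx x + (?N * x) * ln ?N" if "0 \<le> x" for x
    by (rule xlnx_scale[OF N that])
  have e1: "entropy n k = xlnx (?N * 1) - xlnx (?N * b) - xlnx (?N * (1 - b))"
    unfolding entropy_def mult by (simp add: algebra_simps)
  have e2: "entropy (s + m) m = xlnx (?N * (a + g)) - xlnx (?N * a) - xlnx (?N * g)"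
    unfolding entropy_def of_nat_add mult by (simp add: algebra_simps)
  have e3: "entropy (n - s) (k + m) = xlnx (?N * (1 - g)) - xlnx (?N * (a + b)) - xlnx (?N * (1 - a - b - g))"
    unfolding entropy_def of_nat_add sub mult by (simp add: algebra_simps)
  have "entropy n k + entropy (s + m) m - entropy (n - s) (k + m) = ?N * rate a b g"
    unfolding e1 e2 e3 rate_def X[OF zero_le_one] X[OF nonneg(1)] X[OF nonneg(2)] X[OF nonneg(3)]
      X[OF le1(1)] X[OF le1(2)] X[OF le1(3)] X[OF add_nonneg_nonneg[OF nonneg(1) nonneg(2)]]
      X[OF add_nonneg_nonneg[OF nonneg(1) nonneg(3)]]
    by (simp add: algebra_simps)
  then show ?thesis by (simp only: a_def b_def g_def)
qed

lemma binomial_rate_bounds: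
  fixes n k m s :: nat
  assumes "0 < n" "k + m + s \<le> n"
  defines "r \<equiv> rate (real m / real n) (real k / real n) (real s / real n)"
  shows "real ((n - s) choose (k + m)) * exp (real n * r)
      \<le> (real (n + 1) * real (n + 1)) * (real (n choose k) * real ((s + m) choose m))"
    and "real (n choose k) * real ((s + m) choose m)
      \<le> exp (real n * r) * (real (n + 1) * real ((n - s) choose (k + m)))"
proof -
  have le: "k \<le> n" "m \<le> s + m" "k + m \<le> n - s" using assms(2) by auto
  have sum: "entropy (n - s) (k + m) + real n * r = entropy n k + entropy (s + m) m"
    using entropy_rate[OF assms(1,2)] unfolding r_def by linarith
  have "real ((n - s) choose (k + m)) * exp (real n * r) \<le> exp (entropy (n - s) (k + m)) * exp (real n * r)"
    using binomial_le_exp_entropy[OF le(3)] by (rule mult_right_mono) simp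
  also have "\<dots> = exp (entropy n k) * exp (entropy (s + m) m)"
    by (simp only: sum flip: exp_add)
  also have "\<dots> \<le> (real (n + 1) * real (n choose k)) * (real (n + 1) * real ((s + m) choose m))"
  proof (rule mult_mono)
    show "exp (entropy n k) \<le> real (n + 1) * real (n choose k)" by (rule exp_entropy_le_binomial[OF le(1)])
    have "exp (entropy (s + m) m) \<le> real (s + m + 1) * real ((s + m) choose m)"
      by (rule exp_entropy_le_binomial[OF le(2)])
    also have "\<dots> \<le> real (n + 1) * real ((s + m) choose m)" using assms(2) by (intro mult_right_mono) auto
    finally show "exp (entropy (s + m) m) \<le> real (n + 1) * real ((s + m) choose m)" .
  qed auto
  finally show "real ((n - s) choose (k + m)) * exp (real n * r)
      \<le> (real (n + 1) * real (n + 1)) * (real (n choose k) * real ((s + m) choose m))"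
    by (simp only: mult_ac)
  have "real (n choose k) * real ((s + m) choose m) \<le> exp (entropy n k) * exp (entropy (s + m) m)"
    by (intro mult_mono binomial_le_exp_entropy le) auto
  also have "\<dots> = exp (real n * r) * exp (entropy (n - s) (k + m))"
    by (metis exp_add sum add.commute)
  also have "\<dots> \<le> exp (real n * r) * (real (n - s + 1) * real ((n - s) choose (k + m)))"
    by (intro mult_left_mono exp_entropy_le_binomial le) simp
  also have "\<dots> \<le> exp (real n * r) * (real (n + 1) * real ((n - s) choose (k + m)))"
    by (intro mult_left_mono mult_right_mono) auto
  finally show "real (n choose k) * real ((s + m) choose m)
      \<le> exp (real n * r) * (real (n + 1) * real ((n - s) choose (k + m)))" .
qed

text \<open>Differentiability is asked for in the interior only, since \<open>xlnx\<close> has no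
  derivative at 0 and the intervals below may have endpoints where an argument of
  \<open>xlnx\<close> vanishes.\<close>

lemma nondecreasing_if_deriv_nonneg:
  fixes f :: "real \<Rightarrow> real"
  assumes "x \<le> y" "continuous_on {x..y} f"
    and "\<And>z. x < z \<Longrightarrow> z < y \<Longrightarrow> (f has_real_derivative f' z) (at z)"
    and "\<And>z. x < z \<Longrightarrow> z < y \<Longrightarrow> 0 \<le> f' z"
  shows "f x \<le> f y"
proof (cases "x = y")
  case False
  then have "x < y" using assms(1) by simp
  then obtain l z where z: "x < z" "z < y" "DERIV f z :> l" "f y - f x = (y - x) * l"
    using MVT[of x y f] assms(2,3) real_differentiable_def by metis
  then have "l = f' z" using assms(3) DERIV_unique by blast
  then have "0 \<le> (y - x) * l" using assms(4) z \<open>x < y\<close> by simp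
  then show ?thesis using z(4) by linarith
qed simp

lemma continuous_on_xlnx_compose:
  assumes "continuous_on S f" "\<And>x. x \<in> S \<Longrightarrow> 0 \<le> f x"
  shows "continuous_on S (\<lambda>x. xlnx (f x))"
  by (rule continuous_on_compose2[OF continuous_on_xlnx assms(1)]) (use assms(2) in auto)

text \<open>The derivative in \<open>g\<close> is the logarithm of
  \<open>(a+g)(1-g) / (g(1-a-b-g))\<close>. It is at least \<open>- ln (1-b)\<close>, since
  \<open>g \<le> a+g\<close> and \<open>1-a-b-g \<le> (1-g)(1-b)\<close>. The bound does not involve
  \<open>a\<close>, which makes the gain uniform in \<open>m\<close>.\<close>

lemma rate_mono:
  assumes "0 \<le> a" "0 < b" "b < 1" "0 \<le> g" "g \<le> g'" "a + b + g' \<le> 1"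
  shows "rate a b g + (g' - g) * (- ln (1 - b)) \<le> rate a b g'"
proof -
  let ?f = "\<lambda>x. rate a b x + x * ln (1 - b)"
  let ?f' = "\<lambda>x. (ln (a + x) + 1) - (ln (1 - a - b - x) + 1) - (ln x + 1) + (ln (1 - x) + 1) + ln (1 - b)"
  have "?f g \<le> ?f g'"
  proof (rule nondecreasing_if_deriv_nonneg[OF assms(5)])
    show "continuous_on {g..g'} ?f"
      unfolding rate_def using assms
      by (intro continuous_intros continuous_on_xlnx_compose) auto
    fix z assume z: "g < z" "z < g'"
    show "(?f has_real_derivative ?f' z) (at z)"
      unfolding rate_def
      by (rule derivative_eq_intros DERIV_chain2[OF DERIV_xlnx] refl | use z assms in simp)+
    have "ln z \<le> ln (a + z)" using z assms by simp
    moreover have "ln (1 - a - b - z) \<le> ln ((1 - z) * (1 - b))"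
    proof -
      have "0 \<le> z * b" using z assms by simp
      then have "1 - a - b - z \<le> (1 - z) * (1 - b)" using assms by (simp add: algebra_simps)
      moreover have "0 < 1 - a - b - z" using z assms by simp
      ultimately show ?thesis by simp
    qed
    moreover have "ln ((1 - z) * (1 - b)) = ln (1 - z) + ln (1 - b)"
      using z assms by (intro ln_mult_pos) auto
    ultimately show "0 \<le> ?f' z" by linarith
  qed
  then show ?thesis by (simp add: algebra_simps)
qed

section \<open>The rate at a solution of the equation\<close>

locale rate_solution =
  fixes \<beta> \<gamma> :: real
  assumes \<beta>: "0 < \<beta>" "\<beta> \<le> 1 / 2" and sol: "is_solution \<beta> \<gamma>"
begin

definition \<alpha> :: real where
  "\<alpha> = alpha_of \<beta> \<gamma>"

lemma solution_facts:
  shows "0 \<le> \<gamma>" "0 \<le> (1 - 2*\<beta> - 2*\<gamma>)\<^sup>2 - 8*\<beta>*\<gamma>" "0 \<le> \<alpha>" "\<alpha> + \<beta> + \<gamma> \<le> 1" "rate \<alpha> \<beta> \<gamma> = 0"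
proof -
  show 1: "0 \<le> \<gamma>" "0 \<le> (1 - 2*\<beta> - 2*\<gamma>)\<^sup>2 - 8*\<beta>*\<gamma>" "0 \<le> \<alpha>" and 2: "\<alpha> + \<beta> + \<gamma> \<le> 1"
    using sol unfolding is_solution_def Let_def \<alpha>_def by auto
  have "selfpow (\<alpha> + \<gamma>) * selfpow (\<alpha> + \<beta>) * selfpow (1 - \<alpha> - \<beta> - \<gamma>) /
     (selfpow \<alpha> * selfpow \<beta> * selfpow \<gamma> * selfpow (1 - \<beta>) * selfpow (1 - \<gamma>)) = 1"
    using sol unfolding is_solution_def Let_def \<alpha>_def by blast
  then have "exp (rate \<alpha> \<beta> \<gamma>) = 1"
    unfolding rate_def exp_diff exp_add using 1 2 \<beta> by (simp add: selfpow_eq_exp)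
  then show "rate \<alpha> \<beta> \<gamma> = 0" by simp
qed

text \<open>The sign of the left side is that of the derivative of the rate in \<open>a\<close>.
  Expanded it is \<open>2x^2 - (1-2\<beta>-2\<gamma>)x + \<beta>\<gamma>\<close>, so
  \<open>\<alpha>\<close> is its larger root and the other root is half of
  \<open>1-2\<beta>-2\<gamma>\<close> minus \<open>\<alpha>\<close>.\<close>

lemma quadratic_factor:
  "(x + \<gamma>) * (x + \<beta>) - x * (1 - x - \<beta> - \<gamma>) = 2 * (x - \<alpha>) * (x - ((1 - 2*\<beta> - 2*\<gamma>) / 2 - \<alpha>))"
proof -
  define d where "d = sqrt ((1 - 2*\<beta> - 2*\<gamma>)\<^sup>2 - 8*\<beta>*\<gamma>)"
  have d2: "d * d = (1 - 2*\<beta> - 2*\<gamma>)\<^sup>2 - 8*\<beta>*\<gamma>" unfolding d_def using solution_facts(2) by simp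
  have \<alpha>: "\<alpha> = (1 - 2*\<beta> - 2*\<gamma> + d) / 4" by (simp add: \<alpha>_def alpha_of_def d_def)
  have "2 * (x - \<alpha>) * (x - ((1 - 2*\<beta> - 2*\<gamma>) / 2 - \<alpha>))
      = 2 * x * x - (1 - 2*\<beta> - 2*\<gamma>) * x + ((1 - 2*\<beta> - 2*\<gamma>)\<^sup>2 - d * d) / 8"
    unfolding \<alpha> by (simp add: field_simps power2_eq_square)
  also have "\<dots> = (x + \<gamma>) * (x + \<beta>) - x * (1 - x - \<beta> - \<gamma>)"
    unfolding d2 by (simp add: field_simps)
  finally show ?thesis by simp
qed

lemma alpha_ge_conjugate: "(1 - 2*\<beta> - 2*\<gamma>) / 2 - \<alpha> \<le> \<alpha>"
proof -
  define d where "d = sqrt ((1 - 2*\<beta> - 2*\<gamma>)\<^sup>2 - 8*\<beta>*\<gamma>)"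
  have "0 \<le> d" unfolding d_def using solution_facts(2) by simp
  moreover have "\<alpha> = (1 - 2*\<beta> - 2*\<gamma> + d) / 4" by (simp add: \<alpha>_def alpha_of_def d_def)
  ultimately show ?thesis by (simp add: field_simps)
qed

lemma rate_deriv:
  assumes "0 < x" "x + \<beta> + \<gamma> < 1"
  shows "((\<lambda>x. rate x \<beta> \<gamma>) has_real_derivative
     (ln ((x + \<gamma>) * (x + \<beta>)) - ln (x * (1 - x - \<beta> - \<gamma>)))) (at x)"
proof -
  have g: "0 \<le> \<gamma>" by (rule solution_facts)
  have "((\<lambda>x. rate x \<beta> \<gamma>) has_real_derivative
     (ln (x + \<gamma>) + 1) + (ln (x + \<beta>) + 1) - (ln (1 - x - \<beta> - \<gamma>) + 1) - (ln x + 1)) (at x)"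
    unfolding rate_def
    by (rule derivative_eq_intros DERIV_chain2[OF DERIV_xlnx] refl | use assms g \<beta> in simp)+
  moreover have "ln ((x + \<gamma>) * (x + \<beta>)) = ln (x + \<gamma>) + ln (x + \<beta>)"
    "ln (x * (1 - x - \<beta> - \<gamma>)) = ln x + ln (1 - x - \<beta> - \<gamma>)"
    using assms g \<beta> by (auto intro!: ln_mult_pos)
  ultimately show ?thesis by (simp add: algebra_simps)
qed

lemma continuous_on_rate:
  assumes "0 \<le> x" "y + \<beta> + \<gamma> \<le> 1"
  shows "continuous_on {x..y} (\<lambda>x. rate x \<beta> \<gamma>)"
  unfolding rate_def using assms \<beta> solution_facts(1)
  by (intro continuous_intros continuous_on_xlnx_compose) auto

lemma rate_increasing:
  assumes "0 \<le> x" "x \<le> y" "y + \<beta> + \<gamma> \<le> 1"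
    and q: "\<And>z. x < z \<Longrightarrow> z < y \<Longrightarrow> 0 \<le> (z - \<alpha>) * (z - ((1 - 2*\<beta> - 2*\<gamma>) / 2 - \<alpha>))"
  shows "rate x \<beta> \<gamma> \<le> rate y \<beta> \<gamma>"
proof (rule nondecreasing_if_deriv_nonneg[OF assms(2)])
  show "continuous_on {x..y} (\<lambda>x. rate x \<beta> \<gamma>)" using continuous_on_rate assms by blast
  fix z assume z: "x < z" "z < y"
  then have z': "0 < z" "z + \<beta> + \<gamma> < 1" using assms by auto
  show "((\<lambda>x. rate x \<beta> \<gamma>) has_real_derivative
     (ln ((z + \<gamma>) * (z + \<beta>)) - ln (z * (1 - z - \<beta> - \<gamma>)))) (at z)" by (rule rate_deriv[OF z'])
  have "z * (1 - z - \<beta> - \<gamma>) \<le> (z + \<gamma>) * (z + \<beta>)"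
    using q[OF z] quadratic_factor[of z] unfolding mult.assoc[of 2] by linarith
  moreover have "0 < z * (1 - z - \<beta> - \<gamma>)" using z' by simp
  ultimately show "0 \<le> ln ((z + \<gamma>) * (z + \<beta>)) - ln (z * (1 - z - \<beta> - \<gamma>))" by simp
qed

lemma rate_decreasing:
  assumes "0 \<le> x" "x \<le> y" "y + \<beta> + \<gamma> \<le> 1"
    and q: "\<And>z. x < z \<Longrightarrow> z < y \<Longrightarrow> (z - \<alpha>) * (z - ((1 - 2*\<beta> - 2*\<gamma>) / 2 - \<alpha>)) \<le> 0"
  shows "rate y \<beta> \<gamma> \<le> rate x \<beta> \<gamma>"
proof -
  have "- rate x \<beta> \<gamma> \<le> - rate y \<beta> \<gamma>"
  proof (rule nondecreasing_if_deriv_nonneg[OF assms(2)])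
    show "continuous_on {x..y} (\<lambda>x. - rate x \<beta> \<gamma>)"
      using continuous_on_rate assms by (intro continuous_on_minus) blast
    fix z assume z: "x < z" "z < y"
    then have z': "0 < z" "z + \<beta> + \<gamma> < 1" using assms by auto
    show "((\<lambda>x. - rate x \<beta> \<gamma>) has_real_derivative
       - (ln ((z + \<gamma>) * (z + \<beta>)) - ln (z * (1 - z - \<beta> - \<gamma>)))) (at z)"
      by (rule DERIV_minus[OF rate_deriv[OF z']])
    have "(z + \<gamma>) * (z + \<beta>) \<le> z * (1 - z - \<beta> - \<gamma>)"
      using q[OF z] quadratic_factor[of z] unfolding mult.assoc[of 2] by linarith
    moreover have "0 < (z + \<gamma>) * (z + \<beta>)" using z' \<beta> solution_facts(1) by simp
    ultimately show "0 \<le> - (ln ((z + \<gamma>) * (z + \<beta>)) - ln (z * (1 - z - \<beta> - \<gamma>)))" by simp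
  qed
  then show ?thesis by simp
qed

text \<open>As a function of \<open>a\<close> the rate increases from a nonnegative value, then decreases to its
  local minimum \<open>0\<close> at \<open>\<alpha>\<close>, and increases afterwards.\<close>
lemma rate_nonneg:
  assumes "0 \<le> x" "x + \<beta> + \<gamma> \<le> 1"
  shows "0 \<le> rate x \<beta> \<gamma>"
proof -
  let ?c = "(1 - 2*\<beta> - 2*\<gamma>) / 2 - \<alpha>"
  note c = alpha_ge_conjugate
  consider "\<alpha> \<le> x" | "?c \<le> x" "x < \<alpha>" | "x < ?c" by linarith
  then show ?thesis
  proof cases
    case 1
    have "rate \<alpha> \<beta> \<gamma> \<le> rate x \<beta> \<gamma>"
      using c by (intro rate_increasing solution_facts 1 assms mult_nonneg_nonneg) linarith+
    then show ?thesis by (simp add: solution_facts)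
  next
    case 2
    have "rate \<alpha> \<beta> \<gamma> \<le> rate x \<beta> \<gamma>"
      using 2 by (intro rate_decreasing solution_facts assms mult_nonpos_nonneg) linarith+
    then show ?thesis by (simp add: solution_facts)
  next
    case 3
    have "rate 0 \<beta> \<gamma> \<le> rate x \<beta> \<gamma>"
      using 3 c by (intro rate_increasing assms mult_nonpos_nonpos) linarith+
    \<comment> \<open>The starting value at \<open>a = 0\<close>: it vanishes for
      \<open>\<gamma> = 0\<close> and grows with \<open>\<gamma>\<close>.\<close>
    moreover have "rate 0 \<beta> 0 + \<gamma> * (- ln (1 - \<beta>)) \<le> rate 0 \<beta> \<gamma>"
      using rate_mono[of 0 \<beta> 0 \<gamma>] \<beta> solution_facts(1) assms by simp
    moreover have "rate 0 \<beta> 0 = 0" by (simp add: rate_def)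
    moreover have "0 \<le> \<gamma> * (- ln (1 - \<beta>))" using \<beta> solution_facts(1) by (intro mult_nonneg_nonneg) auto
    ultimately show ?thesis by linarith
  qed
qed

lemma alpha_pos: "0 < \<gamma> \<Longrightarrow> 0 < \<alpha>"
  using quadratic_factor[of 0] solution_facts(3) \<beta> by (cases "\<alpha> = 0") auto

text \<open>The limit form of the hypothesis \<open>le\<close> of \<open>syz_coeff_neg\<close>. The
  critical equation gives it with surplus \<open>2\<alpha>^2 + 2\<alpha>\<gamma>\<close>, so it
  survives passing to nearby integers.\<close>

lemma alpha_ratio: "0 < \<gamma> \<Longrightarrow> \<beta> * (\<alpha> + \<gamma>) < (1 - \<beta>) * \<alpha>"
proof -
  assume "0 < \<gamma>"
  have "(\<alpha> + \<gamma>) * (\<alpha> + \<beta>) = \<alpha> * (1 - \<alpha> - \<beta> - \<gamma>)" using quadratic_factor[of \<alpha>] by simp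
  then have "\<beta> * (\<alpha> + \<gamma>) + 2 * (\<alpha> * \<alpha>) + 2 * (\<alpha> * \<gamma>) = (1 - \<beta>) * \<alpha>" by (simp add: algebra_simps)
  moreover have "0 < \<alpha> * \<alpha>" "0 < \<alpha> * \<gamma>" using alpha_pos[OF \<open>0 < \<gamma>\<close>] \<open>0 < \<gamma>\<close> by simp_all
  ultimately show ?thesis by linarith
qed


section \<open>Asymptotic bounds for the Hilbert depth\<close>

lemma eventually_Hdepth1_ge:
  assumes k: "\<And>n. 0 < k n" "(\<lambda>n. real (k n) / real n) \<longlonglongrightarrow> \<beta>" and \<delta>: "0 < \<delta>" "\<delta> < \<beta>"
  shows "eventually (\<lambda>n. n - nat \<lceil>(\<gamma> + \<delta>) * real n\<rceil> \<le> Hdepth1 TYPE('a::field) n (k n)) sequentially"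
proof -
  \<comment> \<open>Eventually \<open>k n / n\<close> is at least \<open>\<beta>/2\<close>, so
    raising \<open>\<gamma>\<close> by \<open>\<delta>\<close> gains at least \<open>2c\<close> in
    the rate. Replacing \<open>\<beta>\<close> by \<open>k n / n\<close> alters four values of
    \<open>xlnx\<close>, each by less than \<open>c/4\<close>; a rate of at least \<open>c\<close>
    remains.\<close>
  define c where "c = \<delta> * (- ln (1 - \<beta> / 2)) / 2"
  have "0 < - ln (1 - \<beta> / 2)" using \<beta> by (simp add: ln_less_zero)
  then have c: "0 < c" unfolding c_def by (intro divide_pos_pos mult_pos_pos \<delta>(1)) simp_all
  have "uniformly_continuous_on {0..1} xlnx"
    by (rule compact_uniformly_continuous[OF continuous_on_subset[OF continuous_on_xlnx]]) auto
  then obtain \<eta> where \<eta>: "0 < \<eta>" and uc: "\<And>x y. x \<in> {0..1} \<Longrightarrow> y \<in> {0..1} \<Longrightarrow> dist y x < \<eta> \<Longrightarrow> dist (xlnx y) (xlnx x) < c / 4"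
    unfolding uniformly_continuous_on_def using c by (metis divide_pos_pos zero_less_numeral)
  define \<epsilon> where "\<epsilon> = min \<eta> (\<delta> / 2)"
  have \<epsilon>: "0 < \<epsilon>" "\<epsilon> \<le> \<eta>" "\<epsilon> \<le> \<delta> / 2" using \<eta> \<delta> by (auto simp: \<epsilon>_def)
  have "eventually (\<lambda>n. dist (real (k n) / real n) \<beta> < \<epsilon>) sequentially"
    using k(2) \<epsilon>(1) by (rule tendstoD)
  \<comment> \<open>Four of the six factors come from \<open>syz_coeff_nonneg\<close>, two from the
    entropy bounds.\<close>
  moreover have "eventually (\<lambda>n. real ((n + 2) ^ 6) \<le> exp (real n * c)) sequentially"
    using c by real_asymp
  ultimately show ?thesis using eventually_gt_at_top[of 0]
  proof eventually_elim
    case (elim n)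
    define s where "s = nat \<lceil>(\<gamma> + \<delta>) * real n\<rceil>"
    define b where "b = real (k n) / real n"
    have N: "0 < real n" using elim by simp
    have g\<delta>: "0 < \<gamma> + \<delta>" using solution_facts(1) \<delta> by simp
    have "0 < (\<gamma> + \<delta>) * real n" using g\<delta> N by simp
    then have s_ge: "(\<gamma> + \<delta>) * real n \<le> real s" and s_pos: "0 < s" unfolding s_def by linarith+
    have "(\<gamma> + \<delta>) * real n \<le> 1 * real n"
      using solution_facts \<delta> by (intro mult_right_mono) auto
    then have s_le: "s \<le> n" unfolding s_def by (simp add: ceiling_le_iff)
    have b: "\<bar>b - \<beta>\<bar> < \<epsilon>" using elim(1) by (simp add: b_def dist_real_def)
    have kb: "real (k n) = b * real n" using N by (simp add: b_def)
    have b\<delta>: "\<bar>b - \<beta>\<bar> < \<delta> / 2" using b \<epsilon> by linarith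
    have kn: "k n \<le> n"
    proof -
      have "b \<le> 1" using b\<delta> \<beta> \<delta> by linarith
      then have "b * real n \<le> 1 * real n" by (rule mult_right_mono) simp
      then show ?thesis using kb by simp
    qed
    have ks: "2 * k n \<le> n + s"
    proof -
      have "2 * b \<le> 1 + (\<gamma> + \<delta>)" using b\<delta> \<beta> solution_facts(1) by linarith
      then have "(2 * b) * real n \<le> (1 + (\<gamma> + \<delta>)) * real n" by (rule mult_right_mono) simp
      then have "2 * real (k n) \<le> real n + real s" using kb s_ge by (simp add: algebra_simps)
      then show ?thesis by linarith
    qed
    have "n - s \<le> Hdepth1 TYPE('a) n (k n)"
    proof (rule Hdepth1_ge_if_coeffs_nonneg[OF k(1) kn s_pos s_le], rule syz_coeff_nonneg[OF k(1) kn s_pos s_le ks])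
      fix m assume km: "k n + m \<le> n - s"
      then have kms: "k n + m + s \<le> n" using s_le by simp
      define a g where "a = real m / real n" and "g = real s / real n"
      have "real (k n + m + s) \<le> real n" using kms by (rule of_nat_mono)
      then have abg: "a + b + g \<le> 1" unfolding a_def b_def g_def using N by (simp add: field_simps)
      have a: "0 \<le> a" by (simp add: a_def)
      have g: "\<gamma> + \<delta> \<le> g" unfolding g_def using s_ge N by (simp add: field_simps)
      have b_pos: "\<beta> / 2 \<le> b" "0 < b" "b < 1" using b\<delta> \<beta> \<delta> by linarith+
      \<comment> \<open>The slack \<open>\<delta>\<close> in \<open>g\<close> exceeds the error of
        \<open>b\<close>, so \<open>a\<close> stays in the range of
        \<open>rate_nonneg\<close>.\<close>
      have ab: "a + \<beta> + \<gamma> \<le> 1" using abg g b\<delta> \<delta> by linarith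
      note g0 = solution_facts(1)
      have "rate a b \<gamma> + (g - \<gamma>) * (- ln (1 - b)) \<le> rate a b g"
        using a b_pos g \<delta> g0 abg by (intro rate_mono) auto
      moreover have "2 * c \<le> (g - \<gamma>) * (- ln (1 - b))"
      proof -
        have "ln (1 - b) \<le> ln (1 - \<beta> / 2)" using b_pos \<beta> by simp
        moreover have "ln (1 - \<beta> / 2) \<le> 0" using \<beta> by simp
        ultimately have "\<delta> * (- ln (1 - \<beta> / 2)) \<le> (g - \<gamma>) * (- ln (1 - b))"
          using g \<delta> by (intro mult_mono) auto
        then show ?thesis by (simp add: c_def)
      qed
      moreover have "rate a \<beta> \<gamma> - c \<le> rate a b \<gamma>"
      proof -
        have X: "\<bar>xlnx y - xlnx x\<bar> < c / 4" if "x \<in> {0..1}" "y \<in> {0..1}" "\<bar>y - x\<bar> < \<epsilon>" for x y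
          using uc[OF that(1,2)] that(3) \<epsilon>(2) by (simp add: dist_real_def)
        have "\<bar>xlnx (a + b) - xlnx (a + \<beta>)\<bar> < c / 4" "\<bar>xlnx (1 - a - b - \<gamma>) - xlnx (1 - a - \<beta> - \<gamma>)\<bar> < c / 4"
          "\<bar>xlnx b - xlnx \<beta>\<bar> < c / 4" "\<bar>xlnx (1 - b) - xlnx (1 - \<beta>)\<bar> < c / 4"
          using a b b_pos abg ab g g0 \<delta> \<beta> by (intro X; simp)+
        then show ?thesis unfolding rate_def by linarith
      qed
      moreover have "0 \<le> rate a \<beta> \<gamma>" by (rule rate_nonneg[OF a ab])
      ultimately have rate: "c \<le> rate a b g" by linarith
      let ?C = "(n - s) choose (k n + m)" and ?B = "(n choose k n) * ((s + m) choose m)"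
      have "(real (n + 1) * real (n + 1)) * (real ((n + 2) ^ 4) * real ?C) \<le> real ?C * real ((n + 2) ^ 6)"
      proof -
        have "(real (n + 1) * real (n + 1)) * real ((n + 2) ^ 4) \<le> (real (n + 2) * real (n + 2)) * real ((n + 2) ^ 4)"
          by (intro mult_right_mono mult_mono) auto
        also have "\<dots> = real ((n + 2) ^ 6)" by (simp only: of_nat_mult of_nat_power) (simp add: eval_nat_numeral)
        finally have "((real (n + 1) * real (n + 1)) * real ((n + 2) ^ 4)) * real ?C \<le> real ((n + 2) ^ 6) * real ?C"
          by (rule mult_right_mono) simp
        then show ?thesis by (simp only: mult_ac)
      qed
      also have "\<dots> \<le> real ?C * exp (real n * c)" using elim(2) by (intro mult_left_mono) auto
      also have "\<dots> \<le> real ?C * exp (real n * rate a b g)"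
        using rate N by (intro mult_left_mono) auto
      also have "\<dots> \<le> (real (n + 1) * real (n + 1)) * (real (n choose k n) * real ((s + m) choose m))"
        using binomial_rate_bounds(1)[OF _ kms] elim(3) by (simp only: a_def b_def g_def)
      finally have "real ((n + 2) ^ 4) * real ?C \<le> real (n choose k n) * real ((s + m) choose m)"
        by (rule mult_left_le_imp_le) simp
      then show "(n + 2) ^ 4 * ?C \<le> ?B" by (simp only: of_nat_le_iff flip: of_nat_mult)
    qed
    then show ?case by (simp only: s_def)
  qed
qed

text \<open>A single negative coefficient suffices. With \<open>m\<close> odd and close to
  \<open>\<alpha>n\<close>, the rate converges to its value at \<open>\<gamma> - \<delta>\<close>,
  which is negative because it vanishes at \<open>\<gamma>\<close>; pointwise continuity replaces
  the uniform estimates.\<close>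

lemma eventually_Hdepth1_less:
  assumes k: "\<And>n. 0 < k n" "(\<lambda>n. real (k n) / real n) \<longlonglongrightarrow> \<beta>" and \<delta>: "0 < \<delta>" "\<delta> < \<gamma>"
  shows "eventually (\<lambda>n. Hdepth1 TYPE('a::field) n (k n) < n - nat \<lfloor>(\<gamma> - \<delta>) * real n\<rfloor>) sequentially"
proof -
  define s where "s n = nat \<lfloor>(\<gamma> - \<delta>) * real n\<rfloor>" for n :: nat
  \<comment> \<open>Odd by construction, so that the isolated binomial coefficient has a minus
    sign.\<close>
  define m where "m n = 2 * nat \<lfloor>(\<alpha> / 2) * real n\<rfloor> + 1" for n :: nat
  have \<gamma>: "0 < \<gamma>" using \<delta> by simp
  have \<alpha>: "0 < \<alpha>" by (rule alpha_pos[OF \<gamma>])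
  have floor_lim: "(\<lambda>n. real (nat \<lfloor>t * real n\<rfloor>) / real n) \<longlonglongrightarrow> t" if "0 < t" for t
  proof (rule tendsto_sandwich)
    show "eventually (\<lambda>n. (t * real n - 1) / real n \<le> real (nat \<lfloor>t * real n\<rfloor>) / real n) sequentially"
      by (intro always_eventually allI divide_right_mono) linarith+
    have le: "real (nat \<lfloor>t * real n\<rfloor>) \<le> t * real n" for n
      using that by (simp add: of_nat_nat)
    show "eventually (\<lambda>n. real (nat \<lfloor>t * real n\<rfloor>) / real n \<le> t) sequentially"
      using eventually_gt_at_top[of 0]
      by eventually_elim (use le in \<open>simp add: field_simps\<close>)
    show "(\<lambda>n. (t * real n - 1) / real n) \<longlonglongrightarrow> t" by real_asymp
  qed simp
  have s_lim: "(\<lambda>n. real (s n) / real n) \<longlonglongrightarrow> \<gamma> - \<delta>" unfolding s_def by (rule floor_lim) (use \<delta> in simp)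
  have "(\<lambda>n. 2 * (real (nat \<lfloor>(\<alpha> / 2) * real n\<rfloor>) / real n) + 1 / real n) \<longlonglongrightarrow> 2 * (\<alpha> / 2) + 0"
    using \<alpha> by (intro tendsto_intros floor_lim lim_1_over_n) auto
  then have m_lim: "(\<lambda>n. real (m n) / real n) \<longlonglongrightarrow> \<alpha>"
    by (simp add: m_def add_divide_distrib add.commute)
  let ?a = "\<lambda>n. real (m n) / real n" and ?b = "\<lambda>n. real (k n) / real n" and ?g = "\<lambda>n. real (s n) / real n"
  note facts = solution_facts
  have sum_lim: "(\<lambda>n. 1 - ?a n - ?b n - ?g n) \<longlonglongrightarrow> 1 - \<alpha> - \<beta> - (\<gamma> - \<delta>)"
    by (intro tendsto_intros m_lim k(2) s_lim)
  have pos: "eventually (\<lambda>n. 0 < 1 - ?a n - ?b n - ?g n) sequentially"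
    by (rule order_tendstoD(1)[OF sum_lim]) (use facts \<delta> in linarith)
  have "(\<lambda>n. (1 - ?b n) * ?a n - ?b n * (?g n + ?a n)) \<longlonglongrightarrow> (1 - \<beta>) * \<alpha> - \<beta> * ((\<gamma> - \<delta>) + \<alpha>)"
    by (intro tendsto_intros m_lim k(2) s_lim)
  then have ratio: "eventually (\<lambda>n. 0 < (1 - ?b n) * ?a n - ?b n * (?g n + ?a n)) sequentially"
  proof (rule order_tendstoD(1))
    have "0 < \<beta> * \<delta>" using \<beta> \<delta> by simp
    then show "0 < (1 - \<beta>) * \<alpha> - \<beta> * ((\<gamma> - \<delta>) + \<alpha>)"
      using alpha_ratio[OF \<gamma>] by (simp add: algebra_simps)
  qed
  define c where "c = \<delta> * (- ln (1 - \<beta>)) / 2"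
  have "0 < - ln (1 - \<beta>)" using \<beta> by (simp add: ln_less_zero)
  then have c: "0 < c" unfolding c_def by (intro divide_pos_pos mult_pos_pos \<delta>(1)) simp_all
  have "rate \<alpha> \<beta> (\<gamma> - \<delta>) + (\<gamma> - (\<gamma> - \<delta>)) * (- ln (1 - \<beta>)) \<le> rate \<alpha> \<beta> \<gamma>"
    using facts \<delta> \<beta> by (intro rate_mono) auto
  then have "rate \<alpha> \<beta> (\<gamma> - \<delta>) \<le> - (2 * c)" using facts(5) by (simp add: c_def)
  moreover have "(\<lambda>n. rate (?a n) (?b n) (?g n)) \<longlonglongrightarrow> rate \<alpha> \<beta> (\<gamma> - \<delta>)"
  proof -
    have ev: "eventually (\<lambda>n. 0 \<le> 1 - ?a n - ?b n - ?g n) sequentially"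
      "eventually (\<lambda>n. 0 \<le> 1 - ?b n) sequentially" "eventually (\<lambda>n. 0 \<le> 1 - ?g n) sequentially"
    proof -
      have nn: "0 \<le> ?a n" "0 \<le> ?b n" "0 \<le> ?g n" for n by simp_all
      show "eventually (\<lambda>n. 0 \<le> 1 - ?a n - ?b n - ?g n) sequentially"
        using pos by (rule eventually_mono) linarith
      show "eventually (\<lambda>n. 0 \<le> 1 - ?b n) sequentially"
      proof (rule eventually_mono[OF pos])
        fix n assume "0 < 1 - ?a n - ?b n - ?g n"
        then show "0 \<le> 1 - ?b n" using nn[of n] by linarith
      qed
      show "eventually (\<lambda>n. 0 \<le> 1 - ?g n) sequentially"
      proof (rule eventually_mono[OF pos])
        fix n assume "0 < 1 - ?a n - ?b n - ?g n"
        then show "0 \<le> 1 - ?g n" using nn[of n] by linarith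
      qed
    qed
    show ?thesis
      unfolding rate_def
      by (intro tendsto_add tendsto_diff tendsto_xlnx tendsto_const m_lim k(2) s_lim ev always_eventually allI add_nonneg_nonneg divide_nonneg_nonneg of_nat_0_le_iff)
        (use facts \<beta> \<delta> in auto)
  qed
  ultimately have rate: "eventually (\<lambda>n. rate (?a n) (?b n) (?g n) < - c) sequentially"
    using c by (intro order_tendstoD(2)) auto
  \<comment> \<open>The factor \<open>n ^ 2\<close> is the one of \<open>syz_coeff_neg\<close>;
    \<open>n + 1\<close> is the loss in the entropy bound.\<close>
  have "eventually (\<lambda>n. real n ^ 2 * real (n + 1) < exp (real n * c)) sequentially"
    using c by real_asymp
  with pos ratio rate show ?thesis using eventually_gt_at_top[of 0]
  proof eventually_elim
    case (elim n)
    have N: "0 < real n" using elim by simp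
    have "0 < (1 - ?a n - ?b n - ?g n) * real n" using elim(1) N by simp
    also have "(1 - ?a n - ?b n - ?g n) * real n = real n - real (m n) - real (k n) - real (s n)"
      using N by (simp add: left_diff_distrib)
    finally have kms: "k n + m n + s n \<le> n" by linarith
    have "0 < ((1 - ?b n) * ?a n - ?b n * (?g n + ?a n)) * (real n * real n)" using elim(2) N by simp
    also have "\<dots> = (real n - real (k n)) * real (m n) - real (k n) * (real (s n) + real (m n))"
      using N by (simp add: field_simps)
    finally have "real (k n * (s n + m n)) < real ((n - k n) * m n)"
      using kms by (simp add: of_nat_diff)
    then have le: "k n * (s n + m n) \<le> (n - k n) * m n" by linarith
    let ?C = "(n - s n) choose (k n + m n)" and ?B = "(n choose k n) * ((s n + m n) choose m n)"
    have "0 < ?C" using kms by simp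
    have "real ?B \<le> exp (real n * rate (?a n) (?b n) (?g n)) * (real (n + 1) * real ?C)"
      using binomial_rate_bounds(2)[OF elim(5) kms] by simp
    also have "\<dots> \<le> exp (- (real n * c)) * (real (n + 1) * real ?C)"
      using elim(3) N by (intro mult_right_mono) (auto simp: mult_le_cancel_left_pos simp flip: mult_minus_right)
    finally have "real n ^ 2 * real ?B \<le> real n ^ 2 * (exp (- (real n * c)) * (real (n + 1) * real ?C))"
      by (rule mult_left_mono) simp
    also have "\<dots> = (real n ^ 2 * real (n + 1)) * (exp (- (real n * c)) * real ?C)" by (simp only: mult_ac)
    also have "\<dots> < exp (real n * c) * (exp (- (real n * c)) * real ?C)"
      using elim(4) \<open>0 < ?C\<close> by (intro mult_strict_right_mono) auto
    also have "\<dots> = real ?C" by (simp add: exp_minus flip: mult.assoc)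
    finally have "n ^ 2 * ?B < ?C" by (simp only: of_nat_less_iff flip: of_nat_mult of_nat_power)
    then have "syz_coeff n (k n) (s n) (m n) < 0"
      using kms le k(1) by (intro syz_coeff_neg) (auto simp: m_def)
    then show ?case using kms k(1) unfolding s_def[symmetric] by (intro Hdepth1_less_if_coeff_neg) auto
  qed
qed

end

theorem theorem4p5:
  fixes \<beta> \<gamma> :: real and k :: "nat \<Rightarrow> nat"
  assumes "0 < \<beta>" and "\<beta> \<le> 1/2"
    and "\<forall>n. 0 < k n"
    and "(\<lambda>n. real (k n) - \<beta> * real n) \<in> o(\<lambda>n. real n)"
    and "is_solution \<beta> \<gamma>"
    and "\<forall>g. is_solution \<beta> g \<longrightarrow> \<gamma> \<le> g"
  shows "(\<lambda>n. real (Hdepth1 TYPE('a::field) n (k n)) - (1 - \<gamma>) * real n) \<in> o(\<lambda>n. real n)"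
proof (rule landau_o.smallI)
  fix \<epsilon> :: real assume \<epsilon>: "0 < \<epsilon>"
  interpret rate_solution \<beta> \<gamma> using assms by unfold_locales auto
  let ?H = "\<lambda>n. Hdepth1 TYPE('a) n (k n)"
  have k: "\<And>n. 0 < k n" using assms(3) by simp
  have "(\<lambda>n. (real (k n) - \<beta> * real n) / real n) \<longlonglongrightarrow> 0" using assms(4) by (rule smalloD_tendsto)
  then have "(\<lambda>n. (real (k n) - \<beta> * real n) / real n + \<beta>) \<longlonglongrightarrow> 0 + \<beta>" by (intro tendsto_intros)
  moreover have "eventually (\<lambda>n. (real (k n) - \<beta> * real n) / real n + \<beta> = real (k n) / real n) sequentially"
    using eventually_gt_at_top[of 0] by eventually_elim (simp add: field_simps)
  ultimately have lim: "(\<lambda>n. real (k n) / real n) \<longlonglongrightarrow> \<beta>"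
    by (simp add: tendsto_cong)
  \<comment> \<open>One half of \<open>\<epsilon>n\<close> pays for rounding \<open>s\<close> to an
    integer, the other for \<open>\<delta>n\<close>.\<close>
  have large: "eventually (\<lambda>n. 1 \<le> \<epsilon> / 2 * real n) sequentially" using \<epsilon> by real_asymp
  have lower: "eventually (\<lambda>n. - (\<epsilon> * real n) \<le> real (?H n) - (1 - \<gamma>) * real n) sequentially"
  proof -
    define \<delta> where "\<delta> = min (\<epsilon> / 2) (\<beta> / 2)"
    have \<delta>: "0 < \<delta>" "\<delta> < \<beta>" "\<delta> \<le> \<epsilon> / 2" using \<epsilon> assms(1) by (auto simp: \<delta>_def)
    show ?thesis
      using eventually_Hdepth1_ge[OF k lim \<delta>(1,2), where ?'a = 'a] large
    proof eventually_elim
      case (elim n)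
      have "0 \<le> (\<gamma> + \<delta>) * real n" using solution_facts(1) \<delta> by simp
      then have "real (nat \<lceil>(\<gamma> + \<delta>) * real n\<rceil>) \<le> (\<gamma> + \<delta>) * real n + 1" by linarith
      then have "real n - ((\<gamma> + \<delta>) * real n + 1) \<le> real (?H n)" using elim(1) by linarith
      moreover have "\<delta> * real n \<le> \<epsilon> / 2 * real n" using \<delta>(3) by (rule mult_right_mono) simp
      ultimately show ?case using elim(2) by (simp add: algebra_simps)
    qed
  qed
  have upper: "eventually (\<lambda>n. real (?H n) - (1 - \<gamma>) * real n \<le> \<epsilon> * real n) sequentially"
  \<comment> \<open>For \<open>\<gamma> = 0\<close> there is no room below \<open>\<gamma>\<close>,
    but the trivial bound by \<open>n\<close> is already what is claimed.\<close>
  proof (cases "\<gamma> = 0")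
    case True
    have "eventually (\<lambda>n. real (k n) / real n < 1) sequentially"
      using lim by (rule order_tendstoD(2)) (use assms(2) in simp)
    then show ?thesis using eventually_gt_at_top[of 0]
    proof eventually_elim
      case (elim n)
      then have "?H n \<le> n" by (intro Hdepth1_le k) (simp add: field_simps)
      moreover have "0 \<le> \<epsilon> * real n" using \<epsilon> by simp
      ultimately show ?case using True by simp
    qed
  next
    case False
    define \<delta> where "\<delta> = min (\<epsilon> / 2) (\<gamma> / 2)"
    have \<delta>: "0 < \<delta>" "\<delta> < \<gamma>" "\<delta> \<le> \<epsilon> / 2" using \<epsilon> False solution_facts(1) by (auto simp: \<delta>_def)
    show ?thesis
      using eventually_Hdepth1_less[OF k lim \<delta>(1,2), where ?'a = 'a] large
    proof eventually_elim
      case (elim n)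
      have "(\<gamma> - \<delta>) * real n - 1 \<le> real (nat \<lfloor>(\<gamma> - \<delta>) * real n\<rfloor>)" by linarith
      then have "real (?H n) \<le> real n - ((\<gamma> - \<delta>) * real n - 1)" using elim(1) by linarith
      moreover have "\<delta> * real n \<le> \<epsilon> / 2 * real n" using \<delta>(3) by (rule mult_right_mono) simp
      ultimately show ?case using elim(2) by (simp add: algebra_simps)
    qed
  qed
  show "eventually (\<lambda>n. norm (real (?H n) - (1 - \<gamma>) * real n) \<le> \<epsilon> * norm (real n)) sequentially"
    using lower upper by eventually_elim (simp add: abs_le_iff)
qed

end
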